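(* Let $\alpha \in (0,1)$ and let $\mathcal{G}$ be a compact, connected metric graph, with a nonempty set $\mathcal{V}_D$ of Dirichlet vertices, in which all vertex degrees are even. Then there exists a cycle graph $\mathcal{C}$ (with a nonempty set of Dirichlet vertices) of the same total length as $\mathcal{G}$ such that $$T_{\alpha}(\mathcal{G}) \leq T_{\alpha}(\mathcal{C}).$$
   Context: A compact metric graph $\mathcal{G}$ is obtained from a finite graph with vertex set $\mathcal{V}$ and edge set $\mathcal{E}$ (loops and parallel edges allowed; a loop contributes 2 to the degree of its vertex) by identifying each edge $e$ with an interval $[0,\ell_e]$, $0<\ell_e<\infty$, and gluing endpoints according to the graph structure. Its total length is $|\mathcal{G}|=\sum_{e}\ell_e$. A nonempty set $\mathcal{V}_D\subseteq\mathcal{V}$ of Dirichlet vertices is fixed. $L^2(\mathcal{G})=\bigoplus_{e}L^2(0,\ell_e)$ with inner product $\langle\cdot,\cdot\rangle$. The Laplacian $-\Delta_{\mathcal{G}}$ acts as $-f_e''$ on each edge, with domain the edgewise $H^2$ functions that are continuous at every vertex, vanish at every $v\in\mathcal{V}_D$, and at every $v\in\mathcal{V}\setminus\mathcal{V}_D$ satisfy the Kirchhoff condition: the sum, over all edge ends incident to $v$, of the derivatives at $v$ taken in the direction pointing into $v$, is zero. It is self-adjoint with compact resolvent, with eigenvalues $0<\lambda_1\le\lambda_2\le\cdots\to\infty$ (with multiplicity) and an $L^2$-orthonormal basis of eigenfunctions $\varphi_n$. For $\alpha\in(0,1)$, $(-\Delta_{\mathcal{G}})^\alpha f=\sum_n\lambda_n^\alpha\langle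 f,\varphi_n\rangle\varphi_n$ on the domain $\{f\in L^2(\mathcal{G}):\sum_n\lambda_n^{2\alpha}|\langle f,\varphi_n\rangle|^2<\infty\}$. The fractional torsion function $u_\alpha$ is the unique solution of $(-\Delta_{\mathcal{G}})^\alpha u_\alpha=1$, i.e. $u_\alpha=\sum_n\lambda_n^{-\alpha}\langle 1,\varphi_n\rangle\varphi_n$, and the fractional torsional rigidity is $T_\alpha(\mathcal{G})=\int_{\mathcal{G}}u_\alpha\,dx=\sum_n\lambda_n^{-\alpha}|\langle1,\varphi_n\rangle|^2$. A cycle graph is a metric graph whose underlying topological space is a single closed loop (a circle of length equal to its total length), with finitely many vertices on it. *)

theory Defs
  imports "HOL-Analysis.Analysis" "Graph_Theory.Digraph"
begin

section \<open>Metric graphs\<close>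

text \<open>
  The finite graph is a multidigraph, so that loops and parallel edges are allowed. The direction of
  an arc \<open>e\<close> only fixes its identification with \<open>[0, len e]\<close>: the point \<open>0\<close> is the tail and
  \<open>len e\<close> is the head.
\<close>

record ('v, 'e) metric_graph =
  skel :: "('v, 'e) pre_digraph"
  len :: "'e \<Rightarrow> real"
  dirichlet :: "'v set"

abbreviation edges :: "('v, 'e) metric_graph \<Rightarrow> 'e set" where
  "edges G \<equiv> arcs (skel G)"

abbreviation vertices :: "('v, 'e) metric_graph \<Rightarrow> 'v set" where
  "vertices G \<equiv> verts (skel G)"

text \<open>
  At least one edge is required: otherwise \<open>L\<^sup>2\<close> is the zero space and there is no sequence of
  eigenvalues.
\<close>

locale metric_graph =
  fixes G :: "('v, 'e) metric_graph"
  assumes fin_digraph_skel: "fin_digraph (skel G)"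
    and edges_nonempty: "edges G \<noteq> {}"
    and len_pos: "e \<in> edges G \<Longrightarrow> 0 < len G e"
    and dirichlet_subset: "dirichlet G \<subseteq> vertices G"

definition total_length :: "('v, 'e) metric_graph \<Rightarrow> real" where
  "total_length G = (\<Sum>e\<in>edges G. len G e)"

text \<open>A loop is both an incoming and an outgoing arc of its vertex and so contributes 2.\<close>

definition vertex_degree :: "('v, 'e) metric_graph \<Rightarrow> 'v \<Rightarrow> nat" where
  "vertex_degree G v = in_degree (skel G) v + out_degree (skel G) v"


subsection \<open>The underlying topological space\<close>

text \<open>
  The space obtained by gluing the intervals \<open>[0, len e]\<close> has as its points the vertices
  (\<open>Inl v\<close>) and the interior points of edges (\<open>Inr (e, x)\<close>); \<open>point G e\<close> maps the interval
  of \<open>e\<close> into it. The topology is the quotient topology: a set is open iff its preimage in every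
  \<open>[0, len e]\<close> is open.
\<close>

definition point :: "('v, 'e) metric_graph \<Rightarrow> 'e \<Rightarrow> real \<Rightarrow> 'v + 'e \<times> real" where
  "point G e x =
    (if x = 0 then Inl (tail (skel G) e)
     else if x = len G e then Inl (head (skel G) e)
     else Inr (e, x))"

definition points :: "('v, 'e) metric_graph \<Rightarrow> ('v + 'e \<times> real) set" where
  "points G = Inl ` vertices G \<union> Inr ` (SIGMA e:edges G. {0<..<len G e})"

definition graph_space :: "('v, 'e) metric_graph \<Rightarrow> ('v + 'e \<times> real) topology" where
  "graph_space G = topology (\<lambda>U. U \<subseteq> points G \<and>
     (\<forall>e\<in>edges G. openin (top_of_set {0..len G e}) {x \<in> {0..len G e}. point G e x \<in> U}))"

lemma openin_graph_space:
  "openin (graph_space G) U \<longleftrightarrow> U \<subseteq> points G \<and>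
     (\<forall>e\<in>edges G. openin (top_of_set {0..len G e}) {x \<in> {0..len G e}. point G e x \<in> U})"
proof -
  let ?pre = "\<lambda>e U. {x \<in> {0..len G e}. point G e x \<in> U}"
  have int: "?pre e (S \<inter> T) = ?pre e S \<inter> ?pre e T" for e S T by auto
  have un: "?pre e (\<Union>K) = (\<Union>U\<in>K. ?pre e U)" for e K by auto
  have "istopology (\<lambda>U. U \<subseteq> points G \<and> (\<forall>e\<in>edges G. openin (top_of_set {0..len G e}) (?pre e U)))"
    unfolding istopology_def int un by (auto intro!: openin_Union)
  then show ?thesis
    unfolding graph_space_def by (simp add: topology_inverse')
qed

definition cycle_graph :: "('v, 'e) metric_graph \<Rightarrow> bool" where
  "cycle_graph C \<longleftrightarrow>
     metric_graph C \<and> graph_space C homeomorphic_space top_of_set (sphere (0::complex) 1)"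


section \<open>The Hilbert space of square integrable functions\<close>

text \<open>
  Functions on a graph are families of functions on the intervals \<open>[0, len e]\<close>; values outside
  these intervals, or for \<open>e\<close> not an edge, are irrelevant.
\<close>

type_synonym 'e graph_fun = "'e \<Rightarrow> real \<Rightarrow> real"

definition square_integrable_on :: "real set \<Rightarrow> (real \<Rightarrow> real) \<Rightarrow> bool" where
  "square_integrable_on S f \<longleftrightarrow>
     set_borel_measurable lborel S f \<and> set_integrable lborel S (\<lambda>x. (f x)\<^sup>2)"

definition L2 :: "('v, 'e) metric_graph \<Rightarrow> 'e graph_fun set" where
  "L2 G = {f. \<forall>e\<in>edges G. square_integrable_on {0..len G e} (f e)}"

definition graph_integral :: "('v, 'e) metric_graph \<Rightarrow> 'e graph_fun \<Rightarrow> real" where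
  "graph_integral G f = (\<Sum>e\<in>edges G. LBINT x:{0..len G e}. f e x)"

definition L2_inner :: "('v, 'e) metric_graph \<Rightarrow> 'e graph_fun \<Rightarrow> 'e graph_fun \<Rightarrow> real" where
  "L2_inner G f g = graph_integral G (\<lambda>e x. f e x * g e x)"

definition L2_norm :: "('v, 'e) metric_graph \<Rightarrow> 'e graph_fun \<Rightarrow> real" where
  "L2_norm G f = sqrt (L2_inner G f f)"

definition L2_sums :: "('v, 'e) metric_graph \<Rightarrow> (nat \<Rightarrow> 'e graph_fun) \<Rightarrow> 'e graph_fun \<Rightarrow> bool" where
  "L2_sums G h f \<longleftrightarrow> (\<lambda>N. L2_norm G (\<lambda>e x. f e x - (\<Sum>n<N. h n e x))) \<longlonglongrightarrow> 0"

definition orthonormal_basis :: "('v, 'e) metric_graph \<Rightarrow> (nat \<Rightarrow> 'e graph_fun) \<Rightarrow> bool" where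
  "orthonormal_basis G \<phi> \<longleftrightarrow>
     (\<forall>n. \<phi> n \<in> L2 G) \<and>
     (\<forall>m n. L2_inner G (\<phi> m) (\<phi> n) = (if m = n then 1 else 0)) \<and>
     (\<forall>f\<in>L2 G. L2_sums G (\<lambda>n e x. L2_inner G f (\<phi> n) * \<phi> n e x) f)"


section \<open>The Laplacian\<close>

text \<open>
  \<open>H2_on l f f' f''\<close> says that \<open>f\<close> is the continuously differentiable representative of an element of
  \<open>H\<^sup>2(0, l)\<close>, with derivative \<open>f'\<close> (one-sided at the endpoints), which is absolutely continuous with
  density \<open>f'' \<in> L\<^sup>2(0, l)\<close>; \<open>f''\<close> is only determined almost everywhere.
\<close>

definition H2_on :: "real \<Rightarrow> (real \<Rightarrow> real) \<Rightarrow> (real \<Rightarrow> real) \<Rightarrow> (real \<Rightarrow> real) \<Rightarrow> bool" where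
  "H2_on l f f' f'' \<longleftrightarrow>
     (\<forall>x\<in>{0..l}. (f has_real_derivative f' x) (at x within {0..l})) \<and>
     square_integrable_on {0..l} f'' \<and>
     (\<forall>x\<in>{0..l}. f' x = f' 0 + (LBINT y:{0..x}. f'' y))"

text \<open>
  \<open>val\<close> is the common value at a vertex. The derivative pointing into the vertex is \<open>f' (len e)\<close>
  at the head of \<open>e\<close> and \<open>- f' 0\<close> at its tail.
\<close>

definition vertex_conditions ::
  "('v, 'e) metric_graph \<Rightarrow> 'e graph_fun \<Rightarrow> 'e graph_fun \<Rightarrow> bool" where
  "vertex_conditions G f f' \<longleftrightarrow>
     (\<exists>val :: 'v \<Rightarrow> real.
        (\<forall>e\<in>edges G. f e 0 = val (tail (skel G) e) \<and> f e (len G e) = val (head (skel G) e)) \<and>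
        (\<forall>v\<in>dirichlet G. val v = 0)) \<and>
     (\<forall>v\<in>vertices G - dirichlet G.
        (\<Sum>e\<in>in_arcs (skel G) v. f' e (len G e)) + (\<Sum>e\<in>out_arcs (skel G) v. - f' e 0) = 0)"

text \<open>\<open>neg_laplacian G f g\<close>: \<open>f\<close> is in the domain of \<open>-\<Delta>\<close> and \<open>-\<Delta> f = g\<close> almost everywhere.\<close>

definition neg_laplacian :: "('v, 'e) metric_graph \<Rightarrow> 'e graph_fun \<Rightarrow> 'e graph_fun \<Rightarrow> bool" where
  "neg_laplacian G f g \<longleftrightarrow>
     (\<exists>f'. (\<forall>e\<in>edges G. H2_on (len G e) (f e) (f' e) (\<lambda>x. - g e x)) \<and> vertex_conditions G f f')"

definition eigenbasis ::
  "('v, 'e) metric_graph \<Rightarrow> (nat \<Rightarrow> real) \<Rightarrow> (nat \<Rightarrow> 'e graph_fun) \<Rightarrow> bool" where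
  "eigenbasis G lam \<phi> \<longleftrightarrow>
     0 < lam 0 \<and> incseq lam \<and> filterlim lam at_top sequentially \<and>
     orthonormal_basis G \<phi> \<and>
     (\<forall>n. neg_laplacian G (\<phi> n) (\<lambda>e x. lam n * \<phi> n e x))"


section \<open>Fractional Laplacian and torsional rigidity\<close>

text \<open>
  \<open>frac_laplacian \<alpha> G f g\<close>: \<open>f\<close> is in the domain of \<open>(-\<Delta>)\<^sup>\<alpha>\<close> and \<open>(-\<Delta>)\<^sup>\<alpha> f = g\<close> in \<open>L\<^sup>2\<close>. The
  operator does not depend on the choice of the eigenbasis.
\<close>

definition frac_laplacian ::
  "real \<Rightarrow> ('v, 'e) metric_graph \<Rightarrow> 'e graph_fun \<Rightarrow> 'e graph_fun \<Rightarrow> bool" where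
  "frac_laplacian \<alpha> G f g \<longleftrightarrow>
     f \<in> L2 G \<and> g \<in> L2 G \<and>
     (\<exists>lam \<phi>. eigenbasis G lam \<phi> \<and>
        summable (\<lambda>n. lam n powr (2 * \<alpha>) * \<bar>L2_inner G f (\<phi> n)\<bar>\<^sup>2) \<and>
        L2_sums G (\<lambda>n e x. lam n powr \<alpha> * L2_inner G f (\<phi> n) * \<phi> n e x) g)"

text \<open>
  The solution of \<open>(-\<Delta>)\<^sup>\<alpha> u = 1\<close> is unique up to null sets. It exists for every connected metric
  graph with a nonempty set of Dirichlet vertices, by the spectral theorem; the other branch of the
  definition only makes it total.
\<close>

definition torsion_function :: "real \<Rightarrow> ('v, 'e) metric_graph \<Rightarrow> 'e graph_fun" where
  "torsion_function \<alpha> G =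
     (if \<exists>u. frac_laplacian \<alpha> G u (\<lambda>e x. 1)
      then SOME u. frac_laplacian \<alpha> G u (\<lambda>e x. 1)
      else (\<lambda>e x. 0))"

definition torsional_rigidity :: "real \<Rightarrow> ('v, 'e) metric_graph \<Rightarrow> real" where
  "torsional_rigidity \<alpha> G = graph_integral G (torsion_function \<alpha> G)"

end

theory Submission
  imports Defs
begin

text \<open>
  Let \<open>L\<close> be the total length of \<open>G\<close>. An Euler circuit through a Dirichlet vertex cuts \<open>G\<close> open to the
  interval \<open>[0, L]\<close>, and \<open>C\<close> is the loop of length \<open>L\<close> whose only vertex is a Dirichlet vertex. A
  function in the form domain of \<open>G\<close> becomes a function in \<open>H\<^sup>1\<^sub>0(0, L)\<close> with the same norm and the
  same energy, so the Laplacian of \<open>G\<close> dominates that of \<open>C\<close> in the sense of forms. By the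
  variational characterisation of the resolvent (testing with the truncated resolvent of \<open>1\<close> on \<open>G\<close>,
  and Bessel's inequality on \<open>C\<close>) this gives, for \<open>s > 0\<close>,
  \<open>\<langle>1, (- \<Delta>\<^sub>G + s)\<^sup>-\<^sup>1 1\<rangle> \<le> \<langle>1, (- \<Delta>\<^sub>C + s)\<^sup>-\<^sup>1 1\<rangle>\<close>, and integrating against \<open>s powr - \<alpha>\<close> yields the
  inequality of the torsional rigidities.

  On \<open>C\<close> the torsion function must be shown to exist, since \<open>torsional_rigidity\<close> would otherwise be
  the junk value \<open>0\<close>; this is where completeness of the sines \<open>sin (n * pi * x / L)\<close> enters. On \<open>G\<close>
  existence is irrelevant: the junk value \<open>0\<close> satisfies the inequality.
\<close>

section \<open>The Hilbert space of a metric graph\<close>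

text \<open>Comparing eigenvalues alone would not decide the question: the rigidity weighs
  \<open>lam n powr - \<alpha>\<close> by the squared coefficients of 1, and these differ on the two
  graphs. The resolvent is the right intermediary because <1, (A + s)^-1 1> is the maximum of 2<f,1>
  - |f'|^2 - s|f|^2 over the form domain. It depends on norm, energy and form domain only, and these
  are what cutting open controls. The comparison has a direction because a function on
  \<open>G\<close> takes equal values whenever the circuit returns to a vertex, a constraint absent
  on the interval; the maximum is thus taken over a smaller set on \<open>G\<close>. Even degrees
  provide the circuit, and starting it at a Dirichlet vertex provides the zero boundary values. The
  rigidity is defined through some eigenbasis, supplied by an existential quantifier, so the
  comparison is made for arbitrary eigenbases of both graphs.\<close>

lemma square_integrable_on_iff:
  "square_integrable_on S f \<longleftrightarrow>
     (\<lambda>x. indicator S x * f x) \<in> borel_measurable borel \<and> integrable lborel (\<lambda>x. (indicator S x * f x)\<^sup>2)"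
proof -
  have "(\<lambda>x. indicator S x *\<^sub>R (f x)\<^sup>2) = (\<lambda>x. (indicator S x * f x)\<^sup>2)"
    by (auto simp: indicator_def)
  then show ?thesis
    by (simp add: square_integrable_on_def set_borel_measurable_def set_integrable_def)
qed

lemma square_integrable_on_times:
  assumes "square_integrable_on S f" "square_integrable_on S g"
  shows "set_integrable lborel S (\<lambda>x. f x * g x)"
proof -
  have [measurable]: "(\<lambda>x. indicator S x * f x) \<in> borel_measurable borel"
      "(\<lambda>x. indicator S x * g x) \<in> borel_measurable borel"
    and int: "integrable lborel (\<lambda>x. (indicator S x * f x)\<^sup>2)"
      "integrable lborel (\<lambda>x. (indicator S x * g x)\<^sup>2)"
    using assms by (auto simp: square_integrable_on_iff)
  have "integrable lborel (\<lambda>x. (indicator S x * f x) * (indicator S x * g x))"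
  proof (rule Bochner_Integration.integrable_bound)
    show "integrable lborel (\<lambda>x. (indicator S x * f x)\<^sup>2 + (indicator S x * g x)\<^sup>2)"
      using int by simp
    have "\<bar>a * b\<bar> \<le> \<bar>a\<^sup>2 + b\<^sup>2\<bar>" for a b :: real
    proof -
      have "0 \<le> \<bar>a * b\<bar>" by (rule abs_ge_zero)
      moreover have "2 * \<bar>a * b\<bar> \<le> a\<^sup>2 + b\<^sup>2"
        using sum_squares_bound[of "\<bar>a\<bar>" "\<bar>b\<bar>"] by (simp add: abs_mult mult.assoc)
      ultimately show ?thesis by linarith
    qed
    then show "AE x in lborel. norm ((indicator S x * f x) * (indicator S x * g x))
        \<le> norm ((indicator S x * f x)\<^sup>2 + (indicator S x * g x)\<^sup>2)"
      by simp
  qed simp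
  also have "(\<lambda>x. (indicator S x * f x) * (indicator S x * g x)) = (\<lambda>x. indicator S x *\<^sub>R (f x * g x))"
    by (auto simp: indicator_def)
  finally show ?thesis
    unfolding set_integrable_def .
qed

lemma square_integrable_on_mult_left:
  "square_integrable_on S f \<Longrightarrow> square_integrable_on S (\<lambda>x. c * f x)"
  unfolding square_integrable_on_iff
  by (auto simp: mult.left_commute[of _ c] power_mult_distrib)

lemma square_integrable_on_add:
  assumes "square_integrable_on S f" "square_integrable_on S g"
  shows "square_integrable_on S (\<lambda>x. f x + g x)"
proof -
  have "set_borel_measurable lborel S (\<lambda>x. f x + g x)"
    using assms unfolding square_integrable_on_def set_borel_measurable_def
    by (auto simp: distrib_left)
  moreover have "set_integrable lborel S (\<lambda>x. (f x)\<^sup>2 + (g x)\<^sup>2 + 2 * (f x * g x))"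
    using assms square_integrable_on_times[OF assms] unfolding square_integrable_on_def
    by (intro set_integral_add) auto
  ultimately show ?thesis
    unfolding square_integrable_on_def by (simp add: power2_sum mult.assoc)
qed

lemma square_integrable_on_diff:
  "square_integrable_on S f \<Longrightarrow> square_integrable_on S g \<Longrightarrow> square_integrable_on S (\<lambda>x. f x - g x)"
  using square_integrable_on_add[of S f "\<lambda>x. - 1 * g x"] square_integrable_on_mult_left[of S g "-1"]
  by simp

lemma square_integrable_on_sum:
  assumes "\<And>i. i \<in> I \<Longrightarrow> square_integrable_on S (f i)"
  shows "square_integrable_on S (\<lambda>x. \<Sum>i\<in>I. f i x)"
proof -
  have "square_integrable_on S (\<lambda>x. 0)"
    by (simp add: square_integrable_on_iff)
  with assms show ?thesis
    by (induction I rule: infinite_finite_induct) (auto intro: square_integrable_on_add)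
qed

lemma square_integrable_on_continuous:
  "continuous_on {a..b} f \<Longrightarrow> square_integrable_on {a..b::real} f"
  unfolding square_integrable_on_def set_borel_measurable_def
  by (auto intro!: borel_integrable_atLeastAtMost' continuous_intros
      borel_measurable_continuous_on_indicator simp del: real_scaleR_def)

context metric_graph
begin

lemma finite_edges: "finite (edges G)"
  using fin_digraph.finite_arcs[OF fin_digraph_skel] .

lemma L2_diff: "f \<in> L2 G \<Longrightarrow> g \<in> L2 G \<Longrightarrow> (\<lambda>e x. f e x - g e x) \<in> L2 G"
  by (auto simp: L2_def intro: square_integrable_on_diff)

lemma L2_scale: "f \<in> L2 G \<Longrightarrow> (\<lambda>e x. c * f e x) \<in> L2 G"
  by (auto simp: L2_def intro: square_integrable_on_mult_left)

lemma L2_sum: "(\<And>i. i \<in> I \<Longrightarrow> f i \<in> L2 G) \<Longrightarrow> (\<lambda>e x. \<Sum>i\<in>I. f i e x) \<in> L2 G"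
  by (auto simp: L2_def intro: square_integrable_on_sum)

lemma L2_continuous: "(\<And>e. e \<in> edges G \<Longrightarrow> continuous_on {0..len G e} (f e)) \<Longrightarrow> f \<in> L2 G"
  by (auto simp: L2_def intro: square_integrable_on_continuous)

lemma L2_const: "(\<lambda>e x. c) \<in> L2 G"
  by (intro L2_continuous continuous_intros)

lemma L2_inner_commute: "L2_inner G f g = L2_inner G g f"
  by (simp add: L2_inner_def mult.commute)

lemma L2_inner_add_left:
  "f \<in> L2 G \<Longrightarrow> g \<in> L2 G \<Longrightarrow> h \<in> L2 G \<Longrightarrow>
     L2_inner G (\<lambda>e x. f e x + g e x) h = L2_inner G f h + L2_inner G g h"
  unfolding L2_inner_def graph_integral_def sum.distrib[symmetric] distrib_right
  by (intro sum.cong refl set_integral_add square_integrable_on_times) (auto simp: L2_def)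

lemma L2_inner_scale_left: "L2_inner G (\<lambda>e x. c * f e x) g = c * L2_inner G f g"
  by (simp add: L2_inner_def graph_integral_def sum_distrib_left mult.assoc)

lemma L2_inner_diff_left:
  assumes "f \<in> L2 G" "g \<in> L2 G" "h \<in> L2 G"
  shows "L2_inner G (\<lambda>e x. f e x - g e x) h = L2_inner G f h - L2_inner G g h"
  using L2_inner_add_left[of f "\<lambda>e x. - 1 * g e x" h] L2_scale[of g "-1"] assms
    L2_inner_scale_left[of "-1" g h] by simp

lemma L2_inner_sum_left:
  assumes "\<And>i. i \<in> I \<Longrightarrow> f i \<in> L2 G" "g \<in> L2 G"
  shows "L2_inner G (\<lambda>e x. \<Sum>i\<in>I. f i e x) g = (\<Sum>i\<in>I. L2_inner G (f i) g)"
proof (cases "finite I")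
  case True
  then show ?thesis using assms(1)
  proof (induction I rule: finite_induct)
    case empty
    then show ?case by (simp add: L2_inner_def graph_integral_def)
  next
    case (insert i I)
    then show ?case
      using L2_inner_add_left[of "f i" "\<lambda>e x. \<Sum>i\<in>I. f i e x" g] L2_sum[of I f] assms(2) by simp
  qed
qed (simp add: L2_inner_def graph_integral_def)

lemma L2_inner_sum_right:
  "(\<And>i. i \<in> I \<Longrightarrow> f i \<in> L2 G) \<Longrightarrow> g \<in> L2 G \<Longrightarrow>
     L2_inner G g (\<lambda>e x. \<Sum>i\<in>I. f i e x) = (\<Sum>i\<in>I. L2_inner G g (f i))"
  by (simp add: L2_inner_commute[of g] L2_inner_sum_left)

lemma L2_inner_scale_right: "L2_inner G g (\<lambda>e x. c * f e x) = c * L2_inner G g f"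
  by (simp add: L2_inner_commute[of g] L2_inner_scale_left)

lemma L2_inner_nonneg: "0 \<le> L2_inner G f f"
  unfolding L2_inner_def graph_integral_def set_lebesgue_integral_def
  by (intro sum_nonneg integral_nonneg_AE) auto

lemma L2_inner_diff_diff:
  assumes "f \<in> L2 G" "g \<in> L2 G"
  shows "L2_inner G (\<lambda>e x. f e x - g e x) (\<lambda>e x. f e x - g e x)
    = L2_inner G f f - 2 * L2_inner G f g + L2_inner G g g"
  using assms L2_diff[OF assms]
  by (simp add: L2_inner_diff_left L2_inner_commute[of f "\<lambda>e x. f e x - g e x"]
      L2_inner_commute[of g "\<lambda>e x. f e x - g e x"] L2_inner_commute[of g f])

text \<open>The discriminant argument for a form that is only semidefinite: functions are not
  identified almost everywhere, so \<open>?c = 0\<close> does not make \<open>g\<close> zero. In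
  that case the quadratic is affine in \<open>t\<close>, and \<open>t = (?a + 1) / (2 * ?b)\<close>
  makes it equal to -1.\<close>

lemma L2_cauchy_schwarz:
  assumes f: "f \<in> L2 G" and g: "g \<in> L2 G"
  shows "\<bar>L2_inner G f g\<bar> \<le> L2_norm G f * L2_norm G g"
proof -
  let ?a = "L2_inner G f f" and ?b = "L2_inner G f g" and ?c = "L2_inner G g g"
  have *: "0 \<le> ?a - 2 * t * ?b + t\<^sup>2 * ?c" for t
    using L2_inner_nonneg[of "\<lambda>e x. f e x - t * g e x"] L2_inner_diff_diff[OF f L2_scale[OF g, of t]]
    by (simp add: L2_inner_scale_left L2_inner_scale_right power2_eq_square mult_ac)
  have "?b\<^sup>2 \<le> ?a * ?c"
  proof (cases "?c = 0")
    case True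
    have "?b = 0"
    proof (rule ccontr)
      assume "?b \<noteq> 0"
      then show False
        using *[of "(?a + 1) / (2 * ?b)"] True by (simp add: field_simps)
    qed
    then show ?thesis using True by simp
  next
    case False
    then have "?c > 0" using L2_inner_nonneg[of g] by simp
    then show ?thesis
      using *[of "?b / ?c"] by (simp add: field_simps power2_eq_square)
  qed
  then show ?thesis
    by (metis L2_norm_def real_sqrt_abs real_sqrt_le_iff real_sqrt_mult)
qed

text \<open>Cauchy-Schwarz applied to the remainder. Through this lemma, series of functions are
  turned into series of real numbers.\<close>

lemma L2_sums_inner:
  assumes "L2_sums G h f" "\<And>n. h n \<in> L2 G" "f \<in> L2 G" "g \<in> L2 G"
  shows "(\<lambda>n. L2_inner G (h n) g) sums L2_inner G f g"
proof -
  have "(\<lambda>N. L2_inner G f g - (\<Sum>n<N. L2_inner G (h n) g)) \<longlonglongrightarrow> 0"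
  proof (rule Lim_null_comparison)
    have "\<bar>L2_inner G f g - (\<Sum>n<N. L2_inner G (h n) g)\<bar>
        \<le> L2_norm G (\<lambda>e x. f e x - (\<Sum>n<N. h n e x)) * L2_norm G g" for N
      using L2_cauchy_schwarz[of "\<lambda>e x. f e x - (\<Sum>n<N. h n e x)" g] L2_diff L2_sum[of _ h] assms
      by (simp add: L2_inner_diff_left L2_inner_sum_left)
    then show "\<forall>\<^sub>F N in sequentially. norm (L2_inner G f g - (\<Sum>n<N. L2_inner G (h n) g))
        \<le> L2_norm G (\<lambda>e x. f e x - (\<Sum>n<N. h n e x)) * L2_norm G g"
      by simp
    show "(\<lambda>N. L2_norm G (\<lambda>e x. f e x - (\<Sum>n<N. h n e x)) * L2_norm G g) \<longlonglongrightarrow> 0"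
      using tendsto_mult_right[of _ 0] assms(1) unfolding L2_sums_def by force
  qed
  from tendsto_diff[OF tendsto_const[of "L2_inner G f g"] this] show ?thesis
    by (simp add: sums_def)
qed

lemma orthonormal_basis_parseval:
  assumes "orthonormal_basis G \<phi>" "f \<in> L2 G" "g \<in> L2 G"
  shows "(\<lambda>n. L2_inner G f (\<phi> n) * L2_inner G g (\<phi> n)) sums L2_inner G f g"
  using L2_sums_inner[of "\<lambda>n e x. L2_inner G f (\<phi> n) * \<phi> n e x" f g] assms L2_scale
  by (auto simp: orthonormal_basis_def L2_inner_scale_left L2_inner_commute[of g])

lemma L2_inner_orthogonal_sum:
  fixes M :: nat
  assumes p: "\<And>m. m < M \<Longrightarrow> p m \<in> L2 G"
    and orth: "\<And>m k. m < M \<Longrightarrow> k < M \<Longrightarrow> L2_inner G (p m) (p k) = (if m = k then \<mu> m else 0)"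
  shows "L2_inner G (\<lambda>e x. \<Sum>m<M. d m * p m e x) (\<lambda>e x. \<Sum>m<M. d m * p m e x) = (\<Sum>m<M. \<mu> m * (d m)\<^sup>2)"
proof -
  let ?q = "\<lambda>e x. \<Sum>m<M. d m * p m e x"
  have q: "?q \<in> L2 G" using p L2_scale by (intro L2_sum) auto
  have "L2_inner G ?q ?q = (\<Sum>m<M. \<Sum>k<M. d m * d k * L2_inner G (p m) (p k))"
    using p L2_scale q
    by (subst L2_inner_sum_left)
      (auto simp: L2_inner_scale_left sum_distrib_left mult.assoc intro!: sum.cong,
       subst L2_inner_sum_right, auto simp: L2_inner_scale_right sum_distrib_left)
  also have "\<dots> = (\<Sum>m<M. \<mu> m * (d m)\<^sup>2)"
  proof (intro sum.cong refl)
    fix m assume m: "m \<in> {..<M}"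
    have "(\<Sum>k<M. d m * d k * L2_inner G (p m) (p k)) = (\<Sum>k<M. if m = k then \<mu> k * (d k)\<^sup>2 else 0)"
      using m orth by (intro sum.cong refl) (simp add: power2_eq_square)
    then show "(\<Sum>k<M. d m * d k * L2_inner G (p m) (p k)) = \<mu> m * (d m)\<^sup>2"
      using m by simp
  qed
  finally show ?thesis .
qed

text \<open>The weights let one inequality serve two families: the pulled-back eigenfunctions of the
  loop (\<open>\<mu> m = 1\<close>) and their derivatives, whose squared norms are the eigenvalues.
  The form \<open>\<mu> m * d m\<close> of the coefficient is the one in which the weak eigenvalue
  equation delivers it.\<close>

lemma bessel_inequality:
  fixes M :: nat
  assumes f: "f \<in> L2 G" and p: "\<And>m. m < M \<Longrightarrow> p m \<in> L2 G"
    and orth: "\<And>m k. m < M \<Longrightarrow> k < M \<Longrightarrow> L2_inner G (p m) (p k) = (if m = k then \<mu> m else 0)"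
    and coef: "\<And>m. m < M \<Longrightarrow> L2_inner G f (p m) = \<mu> m * d m"
  shows "(\<Sum>m<M. \<mu> m * (d m)\<^sup>2) \<le> L2_inner G f f"
proof -
  let ?q = "\<lambda>e x. \<Sum>m<M. d m * p m e x"
  have q: "?q \<in> L2 G" using p L2_scale by (intro L2_sum) auto
  have 1: "L2_inner G f ?q = (\<Sum>m<M. \<mu> m * (d m)\<^sup>2)"
    using p L2_scale f coef
    by (subst L2_inner_sum_right) (auto simp: L2_inner_scale_right power2_eq_square mult_ac)
  show ?thesis
    using L2_inner_orthogonal_sum[of M p \<mu> d, OF p orth] L2_inner_nonneg[of "\<lambda>e x. f e x - ?q e x"] L2_inner_diff_diff[OF f q] 1 by simp
qed

end

section \<open>Density and completeness of the sines\<close>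

lemma square_integrable_dominated_convergence:
  fixes F :: "nat \<Rightarrow> real \<Rightarrow> real"
  assumes F: "\<And>i. square_integrable_on S (F i)" and g: "square_integrable_on S g"
    and w: "square_integrable_on S w" and bound: "\<And>i x. x \<in> S \<Longrightarrow> \<bar>F i x - g x\<bar> \<le> \<bar>w x\<bar>"
    and lim: "AE x in lborel. x \<in> S \<longrightarrow> (\<lambda>i. F i x) \<longlonglongrightarrow> g x"
  shows "(\<lambda>i. LBINT x:S. (F i x - g x)\<^sup>2) \<longlonglongrightarrow> 0"
proof -
  have "(\<lambda>i. \<integral>x. indicator S x *\<^sub>R (F i x - g x)\<^sup>2 \<partial>lborel) \<longlonglongrightarrow> (\<integral>x. 0 \<partial>(lborel::real measure))"
  proof (rule integral_dominated_convergence)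
    show "integrable lborel (\<lambda>x. indicator S x *\<^sub>R (w x)\<^sup>2)"
      using w unfolding square_integrable_on_def set_integrable_def by simp
    show "(\<lambda>x. indicator S x *\<^sub>R (F i x - g x)\<^sup>2) \<in> borel_measurable lborel" for i
      using square_integrable_on_diff[OF F g, of i]
      unfolding square_integrable_on_def set_integrable_def by auto
    show "AE x in lborel. (\<lambda>i. indicator S x *\<^sub>R (F i x - g x)\<^sup>2) \<longlonglongrightarrow> 0"
      using lim
    proof eventually_elim
      case (elim x)
      show "(\<lambda>i. indicator S x *\<^sub>R (F i x - g x)\<^sup>2) \<longlonglongrightarrow> 0"
      proof (cases "x \<in> S")
        case True
        then show ?thesis
          using tendsto_power[OF tendsto_diff[OF elim[rule_format, OF True] tendsto_const[of "g x"]], of 2] by simp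
      qed simp
    qed
    show "AE x in lborel. norm (indicator S x *\<^sub>R (F i x - g x)\<^sup>2) \<le> indicator S x *\<^sub>R (w x)\<^sup>2" for i
      using bound by (auto simp: indicator_def abs_le_square_iff)
  qed simp
  then show ?thesis by (simp add: set_lebesgue_integral_def)
qed

text \<open>Regularity of Lebesgue measure encloses \<open>A\<close> between a closed
  \<open>K\<close> and an open \<open>U\<close>. A Urysohn function for \<open>K\<close> and the
  complement of \<open>U\<close> differs from the indicator only on the small set
  \<open>U - K\<close>, and there by at most 1.\<close>

lemma indicator_approx_continuous:
  fixes A :: "real set"
  assumes A: "A \<in> sets borel" and e: "0 < e"
  obtains f :: "real \<Rightarrow> real" where "continuous_on UNIV f"
    "integrable lborel (\<lambda>x. (f x - indicator A x)\<^sup>2)" "(\<integral>x. (f x - indicator A x)\<^sup>2 \<partial>lborel) \<le> e"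
proof -
  have A': "A \<in> sets lebesgue" using A by simp
  obtain U where U: "open U" "A \<subseteq> U" "emeasure lebesgue (U - A) < ennreal (e/2)"
    using sets_lebesgue_outer_open[OF A', of "e/2"] e by (metis half_gt_zero)
  obtain K where K: "closed K" "K \<subseteq> A" "emeasure lebesgue (A - K) < ennreal (e/2)"
    using sets_lebesgue_inner_closed[OF A', of "e/2"] e by (metis half_gt_zero)
  have [measurable]: "U \<in> sets borel" "K \<in> sets borel" "A \<in> sets borel" using U K A by auto
  obtain f :: "real \<Rightarrow> real" where f: "continuous_on UNIV f" "\<And>x. f x \<in> closed_segment 1 0"
      "\<And>x. x \<in> K \<Longrightarrow> f x = 1" "\<And>x. x \<in> - U \<Longrightarrow> f x = 0"
    using Urysohn_local[of UNIV K "- U" 1 "0::real"] U K by auto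
  have [measurable]: "f \<in> borel_measurable borel"
    using f(1) by (rule borel_measurable_continuous_onI)
  have f01: "0 \<le> f x" "f x \<le> 1" for x using f(2)[of x] by (auto simp: closed_segment_eq_real_ivl)
  have "emeasure lborel (U - K) \<le> emeasure lborel (U - A) + emeasure lborel (A - K)"
    using U(2) K(2) by (subst plus_emeasure) (auto intro!: emeasure_mono)
  also have "\<dots> \<le> ennreal (e/2) + ennreal (e/2)"
    using U(3) K(3) by (intro add_mono) auto
  finally have m: "emeasure lborel (U - K) \<le> ennreal e"
    using e by (simp flip: ennreal_plus)
  then have fin: "emeasure lborel (U - K) < \<infinity>"
    using le_less_trans by fastforce
  have bd: "(f x - indicator A x)\<^sup>2 \<le> indicator (U - K) x" for x
  proof -
    have "\<bar>f x - indicator A x\<bar> \<le> 1" using f01[of x] by (auto simp: indicator_def)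
    then have "(f x - indicator A x)\<^sup>2 \<le> 1" by (simp add: abs_square_le_1)
    moreover have "f x = indicator A x" if "x \<notin> U - K"
      using that f(3,4)[of x] U(2) K(2) by (auto simp: indicator_def)
    ultimately show ?thesis by (auto simp: indicator_def)
  qed
  have int: "integrable lborel (indicator (U - K) :: real \<Rightarrow> real)"
    using fin by (intro integrable_real_indicator) auto
  have i: "integrable lborel (\<lambda>x. (f x - indicator A x)\<^sup>2)"
    by (rule Bochner_Integration.integrable_bound[OF int]) (use bd in auto)
  have "(\<integral>x. (f x - indicator A x)\<^sup>2 \<partial>lborel) \<le> (\<integral>x. indicator (U - K) x \<partial>lborel)"
    using i int bd by (intro integral_mono) auto
  also have "\<dots> \<le> e"
    using m e by (simp add: measure_def enn2real_leI)
  finally show ?thesis using that f(1) i by blast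
qed

text \<open>Density packaged as an induction rule: indicators by regularity, simple functions by
  linearity, the rest by dominated convergence. The case \<open>limit\<close> measures distance on
  the interval only, so it also passes between functions that agree there.\<close>

lemma square_integrable_induct [consumes 1, case_names continuous add scale limit]:
  assumes f: "square_integrable_on {a..b} f"
    and cont: "\<And>g. continuous_on UNIV g \<Longrightarrow> P g"
    and add: "\<And>g h. P g \<Longrightarrow> P h \<Longrightarrow> P (\<lambda>x. g x + h x)"
    and scale: "\<And>c g. P g \<Longrightarrow> P (\<lambda>x. c * g x)"
    and limit: "\<And>F g. (\<And>i::nat. P (F i)) \<Longrightarrow> (\<And>i. square_integrable_on {a..b} (F i)) \<Longrightarrow>
      square_integrable_on {a..b} g \<Longrightarrow> (\<lambda>i. LBINT x:{a..b}. (F i x - g x)\<^sup>2) \<longlonglongrightarrow> 0 \<Longrightarrow> P g"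
  shows "P f"
proof -
  have ind: "P (indicator A)" if [measurable]: "A \<in> sets borel" for A
  proof -
    have "\<forall>i::nat. \<exists>f :: real \<Rightarrow> real. continuous_on UNIV f \<and> integrable lborel (\<lambda>x. (f x - indicator A x)\<^sup>2) \<and>
        (\<integral>x. (f x - indicator A x)\<^sup>2 \<partial>lborel) \<le> 1 / Suc i"
      using indicator_approx_continuous[OF that] by (metis of_nat_0_less_iff zero_less_Suc zero_less_divide_1_iff)
    then obtain F :: "nat \<Rightarrow> real \<Rightarrow> real" where F: "\<And>i. continuous_on UNIV (F i)"
        "\<And>i. integrable lborel (\<lambda>x. (F i x - indicator A x)\<^sup>2)"
        "\<And>i. (\<integral>x. (F i x - indicator A x)\<^sup>2 \<partial>lborel) \<le> 1 / Suc i"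
      by metis
    show ?thesis
    proof (rule limit[of F])
      show "P (F i)" for i using F cont by auto
      show "square_integrable_on {a..b} (F i)" for i
        using F(1) by (intro square_integrable_on_continuous) (auto intro: continuous_on_subset)
      show "square_integrable_on {a..b} (indicator A)"
        unfolding square_integrable_on_iff
        by (auto simp: power2_eq_square simp flip: indicator_inter_arith
            intro!: integrable_real_indicator le_less_trans[OF emeasure_mono[of _ "{a..b}"]]
              emeasure_lborel_Icc_eq[THEN eq_refl, THEN le_less_trans])
      show "(\<lambda>i. LBINT x:{a..b}. (F i x - indicator A x)\<^sup>2) \<longlonglongrightarrow> 0"
      proof (rule tendsto_sandwich[OF _ _ tendsto_const LIMSEQ_inverse_real_of_nat])
        show "\<forall>\<^sub>F i in sequentially. 0 \<le> (LBINT x:{a..b}. (F i x - indicator A x)\<^sup>2)"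
          by (simp add: set_lebesgue_integral_def integral_nonneg_AE)
        have "(LBINT x:{a..b}. (F i x - indicator A x)\<^sup>2) \<le> inverse (real (Suc i))" for i
        proof -
          have "(LBINT x:{a..b}. (F i x - indicator A x)\<^sup>2) \<le> (\<integral>x. (F i x - indicator A x)\<^sup>2 \<partial>lborel)"
            unfolding set_lebesgue_integral_def using F(2)[of i]
            by (intro integral_mono integrable_mult_indicator) (auto simp: indicator_def)
          then show ?thesis using F(3)[of i] unfolding inverse_eq_divide by (rule order_trans)
        qed
        then show "\<forall>\<^sub>F i in sequentially. (LBINT x:{a..b}. (F i x - indicator A x)\<^sup>2) \<le> inverse (real (Suc i))"
          by simp
      qed
    qed
  qed
  have sum: "P (\<lambda>x. \<Sum>y\<in>Y. y * indicator (A y) x)"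
    if "finite Y" "\<And>y. A y \<in> sets borel" for Y :: "real set" and A
    using that(1)
  proof (induction Y rule: finite_induct)
    case empty
    show ?case by (simp add: cont)
  next
    case (insert y Y)
    have "P (\<lambda>x. y * indicator (A y) x + (\<Sum>y\<in>Y. y * indicator (A y) x))"
      by (intro add scale ind that(2) insert.IH)
    then show ?case using insert.hyps by (simp only: sum.insert not_False_eq_True)
  qed
  have simple: "P s" if s: "simple_function borel s" for s :: "real \<Rightarrow> real"
  proof -
    have "P (\<lambda>x. \<Sum>y\<in>range s. y * indicator (s -` {y}) x)"
    proof (rule sum)
      show "finite (range s)" using simple_functionD(1)[OF s] by simp
      show "s -` {y} \<in> sets borel" for y using simple_functionD(2)[OF s, of "{y}"] by simp
    qed
    also have "(\<lambda>x. \<Sum>y\<in>range s. y * indicator (s -` {y}) x) = s"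
    proof
      fix x
      have "(\<Sum>y\<in>range s. y * indicator (s -` {y}) x) = (\<Sum>y\<in>range s. if y = s x then y else 0)"
        by (intro sum.cong) auto
      then show "(\<Sum>y\<in>range s. y * indicator (s -` {y}) x) = s x"
        using s by (simp add: simple_function_def)
    qed
    finally show ?thesis .
  qed
  \<comment> \<open>Outside the interval \<open>f\<close> may fail to be measurable, so the simple
    functions approximate its cut-off.\<close>
  let ?f = "\<lambda>x. indicator {a..b} x * f x"
  have "?f \<in> borel_measurable borel" using f by (simp add: square_integrable_on_iff)
  then obtain s where s: "\<And>i. simple_function borel (s i)" "\<And>x. (\<lambda>i. s i x) \<longlonglongrightarrow> ?f x"
      "\<And>i x. \<bar>s i x\<bar> \<le> 2 * \<bar>?f x\<bar>"
    using borel_measurable_implies_sequence_metric[of ?f borel 0] by auto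
  have s2: "square_integrable_on {a..b} (s i)" for i
    unfolding square_integrable_on_iff
  proof
    have [measurable]: "s i \<in> borel_measurable borel"
      using s(1) by (rule borel_measurable_simple_function)
    show "(\<lambda>x. indicator {a..b} x * s i x) \<in> borel_measurable borel" by measurable
    show "integrable lborel (\<lambda>x. (indicator {a..b} x * s i x)\<^sup>2)"
    proof (rule Bochner_Integration.integrable_bound)
      show "integrable lborel (\<lambda>x. (2 * ?f x)\<^sup>2)"
        using f by (simp add: square_integrable_on_iff power_mult_distrib)
      have le: "(s i x)\<^sup>2 \<le> (2 * ?f x)\<^sup>2" for x
      proof (rule abs_le_square_iff[THEN iffD1])
        show "\<bar>s i x\<bar> \<le> \<bar>2 * ?f x\<bar>" using s(3)[of i x] by (simp add: abs_mult)
      qed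
      have "norm ((indicator {a..b} x * s i x)\<^sup>2) \<le> norm ((2 * ?f x)\<^sup>2)" for x
        using le[of x] by (cases "x \<in> {a..b}") simp_all
      then show "AE x in lborel. norm ((indicator {a..b} x * s i x)\<^sup>2) \<le> norm ((2 * ?f x)\<^sup>2)"
        by simp
    qed measurable
  qed
  show ?thesis
  proof (rule limit[OF simple[OF s(1)] s2 f])
    show "(\<lambda>i. LBINT x:{a..b}. (s i x - f x)\<^sup>2) \<longlonglongrightarrow> 0"
    proof (rule square_integrable_dominated_convergence[OF s2 f])
      \<comment> \<open>The factor 3 adds the bound 2 |f| on the simple functions to |f|
        itself.\<close>
      show "square_integrable_on {a..b} (\<lambda>x. 3 * f x)"
        using f by (rule square_integrable_on_mult_left)
      show "\<bar>s i x - f x\<bar> \<le> \<bar>3 * f x\<bar>" if "x \<in> {a..b}" for i x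
        using s(3)[of i x] that by simp
      show "AE x in lborel. x \<in> {a..b} \<longrightarrow> (\<lambda>i. s i x) \<longlonglongrightarrow> f x"
        using s(2) by (intro AE_I2) (metis indicator_simps(1) mult_1)
    qed
  qed
qed

lemma square_integrable_on_mult_continuous:
  assumes f: "square_integrable_on {a..b} f" and h: "continuous_on {a..b} h"
  shows "square_integrable_on {a..b::real} (\<lambda>x. h x * f x)"
proof -
  obtain B where "\<forall>y\<in>h ` {a..b}. norm y \<le> B"
    using compact_imp_bounded[OF compact_continuous_image[OF h compact_Icc]]
    unfolding bounded_iff by blast
  then have B: "\<bar>h x\<bar> \<le> B" if "x \<in> {a..b}" for x using that by simp
  have meas: "(\<lambda>x. indicator {a..b} x * f x) \<in> borel_measurable borel"
      "(\<lambda>x. indicator {a..b} x * h x) \<in> borel_measurable borel"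
    using f square_integrable_on_continuous[OF h] by (auto simp: square_integrable_on_iff)
  have eq: "(\<lambda>x. indicator {a..b} x * (h x * f x))
      = (\<lambda>x. (indicator {a..b} x * h x) * (indicator {a..b} x * f x))"
    by (auto simp: indicator_def)
  have meas': "(\<lambda>x. indicator {a..b} x * (h x * f x)) \<in> borel_measurable borel"
    unfolding eq by (intro borel_measurable_times meas)
  show ?thesis
    unfolding square_integrable_on_iff
  proof (rule conjI[OF meas'])
    show "integrable lborel (\<lambda>x. (indicator {a..b} x * (h x * f x))\<^sup>2)"
    proof (rule Bochner_Integration.integrable_bound)
      show "integrable lborel (\<lambda>x. (B * (indicator {a..b} x * f x))\<^sup>2)"
        using f by (simp add: square_integrable_on_iff power_mult_distrib)
      show "(\<lambda>x. (indicator {a..b} x * (h x * f x))\<^sup>2) \<in> borel_measurable lborel"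
        using borel_measurable_power[OF meas', of 2] by simp
      have "(indicator {a..b} x * (h x * f x))\<^sup>2 \<le> (B * (indicator {a..b} x * f x))\<^sup>2" for x
      proof (cases "x \<in> {a..b}")
        case True
        then have "\<bar>h x\<bar> \<le> \<bar>B\<bar>" using B[of x] by linarith
        then show ?thesis
          using True by (simp add: abs_le_square_iff[symmetric] abs_mult mult_right_mono)
      qed simp
      then show "AE x in lborel. norm ((indicator {a..b} x * (h x * f x))\<^sup>2)
          \<le> norm ((B * (indicator {a..b} x * f x))\<^sup>2)"
        by simp
    qed
  qed
qed

lemma square_integrable_set_integrable:
  "square_integrable_on S f \<Longrightarrow> set_integrable lborel S (\<lambda>x. (f x)\<^sup>2)"
  by (simp add: square_integrable_on_def)

text \<open>From (x + y)^2 <= 2 x^2 + 2 y^2. The factor 2 is why the approximations below are taken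
  within a quarter of the tolerance.\<close>

lemma square_integral_triangle:
  assumes "square_integrable_on S u" "square_integrable_on S v" "square_integrable_on S w"
  shows "(LBINT x:S. (u x - w x)\<^sup>2) \<le> 2 * (LBINT x:S. (u x - v x)\<^sup>2) + 2 * (LBINT x:S. (v x - w x)\<^sup>2)"
proof -
  note int = square_integrable_set_integrable[OF square_integrable_on_diff]
  have *: "(a - c)\<^sup>2 \<le> 2 * (a - b)\<^sup>2 + 2 * (b - c)\<^sup>2" for a b c :: real
    using sum_squares_bound[of "a - b" "b - c"] zero_le_power2[of "a - b - (b - c)"]
    by (simp add: power2_eq_square algebra_simps)
  have "(LBINT x:S. (u x - w x)\<^sup>2) \<le> (LBINT x:S. 2 * (u x - v x)\<^sup>2 + 2 * (v x - w x)\<^sup>2)"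
    using assms * int by (intro set_integral_mono set_integral_add) auto
  also have "\<dots> = 2 * (LBINT x:S. (u x - v x)\<^sup>2) + 2 * (LBINT x:S. (v x - w x)\<^sup>2)"
    using assms int by (subst set_integral_add) auto
  finally show ?thesis .
qed

text \<open>An inductive predicate for the span of the sines, so that closure under multiplication
  by a cosine follows by rule induction. The instance \<open>n = 0\<close> of \<open>base\<close>
  supplies the zero function.\<close>

inductive sine_poly :: "real \<Rightarrow> (real \<Rightarrow> real) \<Rightarrow> bool" for L where
  base: "sine_poly L (\<lambda>x. sin (real n * pi * x / L))"
| add: "sine_poly L p \<Longrightarrow> sine_poly L q \<Longrightarrow> sine_poly L (\<lambda>x. p x + q x)"
| scale: "sine_poly L p \<Longrightarrow> sine_poly L (\<lambda>x. c * p x)"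

lemma sine_poly_continuous: "sine_poly L p \<Longrightarrow> continuous_on A p"
proof (induction rule: sine_poly.induct)
  case (base n)
  have "continuous_on A (\<lambda>x. sin ((real n * pi / L) * x))" by (intro continuous_intros)
  then show ?case by simp
qed (auto intro!: continuous_intros)

lemma sine_poly_zero: "sine_poly L (\<lambda>x. 0)"
  using sine_poly.base[of L 0] by simp

lemma sine_poly_sum:
  "(\<And>i. i \<in> I \<Longrightarrow> sine_poly L (p i)) \<Longrightarrow> sine_poly L (\<lambda>x. \<Sum>i\<in>I. p i x)"
  by (induction I rule: infinite_finite_induct) (auto intro: sine_poly_zero sine_poly.add)

text \<open>Product-to-sum: 2 sin(n t) cos t = sin((n+1) t) + sin((n-1) t). The case
  \<open>n = 0\<close> is separate because n - 1 would leave the naturals.\<close>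

lemma sine_poly_times_cos: "sine_poly L p \<Longrightarrow> sine_poly L (\<lambda>x. p x * cos (pi * x / L))"
proof (induction rule: sine_poly.induct)
  case (base n)
  show ?case
  proof (cases n)
    case 0
    then show ?thesis by (simp add: sine_poly_zero)
  next
    case (Suc m)
    have "sine_poly L (\<lambda>x. (1/2) * (sin (real (Suc n) * pi * x / L) + sin (real m * pi * x / L)))"
      by (intro sine_poly.intros)
    also have "(\<lambda>x. (1/2) * (sin (real (Suc n) * pi * x / L) + sin (real m * pi * x / L)))
        = (\<lambda>x. sin (real n * pi * x / L) * cos (pi * x / L))"
    proof
      fix x
      have e: "real (Suc n) * pi * x / L = real n * pi * x / L + pi * x / L"
        "real m * pi * x / L = real n * pi * x / L - pi * x / L"
        using Suc by (simp_all add: algebra_simps add_divide_distrib diff_divide_distrib)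
      show "(1/2) * (sin (real (Suc n) * pi * x / L) + sin (real m * pi * x / L))
          = sin (real n * pi * x / L) * cos (pi * x / L)"
        unfolding e sin_add sin_diff by simp
    qed
    finally show ?thesis .
  qed
next
  case (add p q)
  then show ?case by (simp add: distrib_right sine_poly.add)
next
  case (scale p c)
  then show ?case using sine_poly.scale[of L "\<lambda>x. p x * cos (pi * x / L)" c] by (simp add: mult.assoc)
qed

text \<open>Repeated multiplication by the cosine, starting from the first sine, reaches every sin t
  * (cos t)^i. This inverts the Chebyshev expansion sin((n+1) t) = sin t * U_n(cos t).\<close>

lemma sine_poly_sin_times_poly_cos:
  assumes "real_polynomial_function g"
  shows "sine_poly L (\<lambda>x. sin (pi * x / L) * g (cos (pi * x / L)))"
proof -
  obtain a n where g: "g = (\<lambda>x. \<Sum>i\<le>n. a i * x ^ i)"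
    using assms real_polynomial_function_iff_sum by auto
  have pow: "sine_poly L (\<lambda>x. sin (pi * x / L) * cos (pi * x / L) ^ i)" for i
  proof (induction i)
    case 0
    then show ?case using sine_poly.base[of L 1] by simp
  next
    case (Suc i)
    then show ?case using sine_poly_times_cos[OF Suc] by (simp add: mult_ac)
  qed
  have "sine_poly L (\<lambda>x. \<Sum>i\<le>n. a i * (sin (pi * x / L) * cos (pi * x / L) ^ i))"
    by (intro sine_poly_sum sine_poly.scale pow)
  then show ?thesis by (simp add: g sum_distrib_left mult_ac)
qed

text \<open>One coefficient sequence, in effect padded by zeros, serves all lengths from
  \<open>N\<close> on: two expansions can then be added at a common length, and
  \<open>orthonormal_basisI\<close> asks for approximations at every large length. The index
  \<open>Suc n\<close> drops the vanishing sine of frequency 0.\<close>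

lemma sine_poly_coefficients:
  assumes "sine_poly L p"
  shows "\<exists>N c. \<forall>M\<ge>N. p = (\<lambda>x. \<Sum>n<M. c n * sin (real (Suc n) * pi * x / L))"
  using assms
proof (induction rule: sine_poly.induct)
  case (base n)
  show ?case
  proof (cases n)
    case 0
    then show ?thesis by (intro exI[of _ 0] exI[of _ "\<lambda>_. 0"]) auto
  next
    case (Suc m)
    have "(\<Sum>k<M. (if k = m then 1 else 0) * sin (real (Suc k) * pi * x / L)) = sin (real n * pi * x / L)"
      if "Suc m \<le> M" for M x
    proof -
      have "(\<Sum>k<M. (if k = m then 1 else 0) * sin (real (Suc k) * pi * x / L))
          = (\<Sum>k<M. if k = m then sin (real (Suc k) * pi * x / L) else 0)"
        by (intro sum.cong) auto
      then show ?thesis using that Suc by simp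
    qed
    then show ?thesis by (intro exI[of _ "Suc m"] exI[of _ "\<lambda>k. if k = m then 1 else 0"]) auto
  qed
next
  case (add p q)
  then obtain N c N' c' where
    "\<forall>M\<ge>N. p = (\<lambda>x. \<Sum>n<M. c n * sin (real (Suc n) * pi * x / L))"
    "\<forall>M\<ge>N'. q = (\<lambda>x. \<Sum>n<M. c' n * sin (real (Suc n) * pi * x / L))"
    by blast
  then have "(\<lambda>x. p x + q x) = (\<lambda>x. \<Sum>n<M. (c n + c' n) * sin (real (Suc n) * pi * x / L))"
    if "M \<ge> max N N'" for M
    using that unfolding distrib_right sum.distrib by auto
  then show ?case by (intro exI[of _ "max N N'"] exI[of _ "\<lambda>n. c n + c' n"]) blast
next
  case (scale p a)
  then obtain N c where
    "\<forall>M\<ge>N. p = (\<lambda>x. \<Sum>n<M. c n * sin (real (Suc n) * pi * x / L))"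
    by blast
  then have "(\<lambda>x. a * p x) = (\<lambda>x. \<Sum>n<M. (a * c n) * sin (real (Suc n) * pi * x / L))"
    if "M \<ge> N" for M
    using that unfolding mult.assoc[of a] sum_distrib_left[symmetric] by auto
  then show ?case by (intro exI[of _ N] exI[of _ "\<lambda>n. a * c n"]) blast
qed

section \<open>The L2 closure of the sine polynomials\<close>

definition sine_approximable :: "real \<Rightarrow> (real \<Rightarrow> real) \<Rightarrow> bool" where
  "sine_approximable L f \<longleftrightarrow> square_integrable_on {0..L} f \<and>
     (\<forall>\<epsilon>>0. \<exists>p. sine_poly L p \<and> (LBINT x:{0..L}. (f x - p x)\<^sup>2) < \<epsilon>)"

lemma sine_approximable_limit:
  fixes F :: "nat \<Rightarrow> real \<Rightarrow> real"
  assumes F: "\<And>i. sine_approximable L (F i)" and g: "square_integrable_on {0..L} g"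
    and lim: "(\<lambda>i. LBINT x:{0..L}. (F i x - g x)\<^sup>2) \<longlonglongrightarrow> 0"
  shows "sine_approximable L g"
  unfolding sine_approximable_def
proof (intro conjI allI impI g)
  fix \<epsilon> :: real assume e: "\<epsilon> > 0"
  have "\<forall>\<^sub>F i in sequentially. (LBINT x:{0..L}. (F i x - g x)\<^sup>2) < \<epsilon>/4"
    using lim e by (intro order_tendstoD(2)) auto
  then obtain i where i: "(LBINT x:{0..L}. (F i x - g x)\<^sup>2) < \<epsilon>/4"
    by (auto simp: eventually_sequentially)
  obtain p where p: "sine_poly L p" "(LBINT x:{0..L}. (F i x - p x)\<^sup>2) < \<epsilon>/4"
    using F[of i] e unfolding sine_approximable_def by (meson zero_less_divide_iff zero_less_numeral)
  have "(LBINT x:{0..L}. (g x - p x)\<^sup>2)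
      \<le> 2 * (LBINT x:{0..L}. (g x - F i x)\<^sup>2) + 2 * (LBINT x:{0..L}. (F i x - p x)\<^sup>2)"
    using F[of i] g square_integrable_on_continuous[OF sine_poly_continuous[OF p(1)]]
    unfolding sine_approximable_def by (intro square_integral_triangle) auto
  also have "\<dots> < \<epsilon>" using i p(2) by (simp add: power2_commute[of "g _"])
  finally show "\<exists>p. sine_poly L p \<and> (LBINT x:{0..L}. (g x - p x)\<^sup>2) < \<epsilon>" using p(1) by blast
qed

lemma sine_approximable_add:
  assumes "sine_approximable L f" "sine_approximable L g"
  shows "sine_approximable L (\<lambda>x. f x + g x)"
  unfolding sine_approximable_def
proof (intro conjI allI impI)
  have fg: "square_integrable_on {0..L} f" "square_integrable_on {0..L} g"
    using assms by (auto simp: sine_approximable_def)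
  then show "square_integrable_on {0..L} (\<lambda>x. f x + g x)" by (rule square_integrable_on_add)
  fix \<epsilon> :: real assume e: "\<epsilon> > 0"
  obtain p q where p: "sine_poly L p" "(LBINT x:{0..L}. (f x - p x)\<^sup>2) < \<epsilon>/4"
      and q: "sine_poly L q" "(LBINT x:{0..L}. (g x - q x)\<^sup>2) < \<epsilon>/4"
    using assms e unfolding sine_approximable_def by (meson zero_less_divide_iff zero_less_numeral)
  have pq: "square_integrable_on {0..L} p" "square_integrable_on {0..L} q"
    using p q by (auto intro!: square_integrable_on_continuous sine_poly_continuous)
  have "(LBINT x:{0..L}. ((f x + g x) - (p x + q x))\<^sup>2)
      \<le> 2 * (LBINT x:{0..L}. ((f x + g x) - (p x + g x))\<^sup>2) + 2 * (LBINT x:{0..L}. ((p x + g x) - (p x + q x))\<^sup>2)"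
    using fg pq by (intro square_integral_triangle square_integrable_on_add)
  also have "\<dots> < \<epsilon>" using p q by simp
  finally show "\<exists>p. sine_poly L p \<and> (LBINT x:{0..L}. (f x + g x - p x)\<^sup>2) < \<epsilon>"
    using sine_poly.add[OF p(1) q(1)] by blast
qed

lemma sine_approximable_scale:
  assumes "sine_approximable L f"
  shows "sine_approximable L (\<lambda>x. c * f x)"
  unfolding sine_approximable_def
proof (intro conjI allI impI)
  show "square_integrable_on {0..L} (\<lambda>x. c * f x)"
    using assms square_integrable_on_mult_left unfolding sine_approximable_def by blast
  fix \<epsilon> :: real assume e: "\<epsilon> > 0"
  then have "\<epsilon> / (c\<^sup>2 + 1) > 0" by (simp add: add_nonneg_pos)
  then obtain p where p: "sine_poly L p" "(LBINT x:{0..L}. (f x - p x)\<^sup>2) < \<epsilon> / (c\<^sup>2 + 1)"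
    using assms unfolding sine_approximable_def by blast
  have "0 \<le> (LBINT x:{0..L}. (f x - p x)\<^sup>2)"
    by (simp add: set_lebesgue_integral_def integral_nonneg_AE)
  then have "c\<^sup>2 * (LBINT x:{0..L}. (f x - p x)\<^sup>2) \<le> (c\<^sup>2 + 1) * (LBINT x:{0..L}. (f x - p x)\<^sup>2)"
    by (intro mult_right_mono) auto
  also have "\<dots> < \<epsilon>"
    using p(2) pos_less_divide_eq[of "c\<^sup>2 + 1"] by (simp add: mult.commute add_nonneg_pos)
  finally have "(LBINT x:{0..L}. (c * f x - c * p x)\<^sup>2) < \<epsilon>"
    by (simp add: power_mult_distrib flip: right_diff_distrib)
  then show "\<exists>p. sine_poly L p \<and> (LBINT x:{0..L}. (c * f x - p x)\<^sup>2) < \<epsilon>"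
    using sine_poly.scale[OF p(1)] by blast
qed

text \<open>
  In the variable \<open>t = cos (pi * x / L)\<close> the function \<open>g\<close> is uniformly close to a polynomial, and the
  factor \<open>sin (pi * x / L)\<close> turns polynomials in \<open>t\<close> into combinations of sines.
\<close>

lemma sine_approximable_sin_times_continuous:
  assumes g: "continuous_on UNIV g" and L: "0 < L"
  shows "sine_approximable L (\<lambda>x. sin (pi * x / L) * g x)"
  unfolding sine_approximable_def
proof (intro conjI allI impI)
  have contg: "continuous_on A g" for A using g continuous_on_subset by blast
  show "square_integrable_on {0..L} (\<lambda>x. sin (pi * x / L) * g x)"
    by (intro square_integrable_on_continuous continuous_intros contg) (use L in auto)
  fix \<epsilon> :: real assume e: "\<epsilon> > 0"
  \<comment> \<open>A uniform error \<open>d\<close> costs at most \<open>d\<^sup>2 * L\<close> in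
    squared L2 distance, which is half of \<open>\<epsilon>\<close>.\<close>
  define d where "d = sqrt (\<epsilon> / (2 * L))"
  have d: "d > 0" "d\<^sup>2 * L < \<epsilon>" using e L by (auto simp: d_def field_simps)
  have "continuous_on {-1..1} (\<lambda>t. g (L / pi * arccos t))"
    by (intro continuous_on_compose2[OF g] continuous_intros) auto
  then obtain q where q: "real_polynomial_function q"
      "\<And>t. t \<in> {-1..1} \<Longrightarrow> \<bar>g (L / pi * arccos t) - q t\<bar> < d"
    using Stone_Weierstrass_real_polynomial_function[OF compact_Icc _ d(1)] by blast
  let ?p = "\<lambda>x. sin (pi * x / L) * q (cos (pi * x / L))"
  have p: "sine_poly L ?p" using q(1) by (rule sine_poly_sin_times_poly_cos)
  have bd: "(sin (pi * x / L) * g x - ?p x)\<^sup>2 \<le> d\<^sup>2" if "x \<in> {0..L}" for x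
  proof -
    have "arccos (cos (pi * x / L)) = pi * x / L"
      using that L by (intro arccos_cos) (auto simp: field_simps)
    then have "\<bar>g x - q (cos (pi * x / L))\<bar> < d"
      using q(2)[of "cos (pi * x / L)"] L by simp
    then have "\<bar>sin (pi * x / L)\<bar> * \<bar>g x - q (cos (pi * x / L))\<bar> \<le> 1 * d"
      by (intro mult_mono) auto
    then have "\<bar>sin (pi * x / L) * g x - ?p x\<bar> \<le> \<bar>d\<bar>"
      using d by (simp flip: right_diff_distrib add: abs_mult)
    then show ?thesis by (simp add: abs_le_square_iff)
  qed
  have "(LBINT x:{0..L}. (sin (pi * x / L) * g x - ?p x)\<^sup>2) \<le> (LBINT x:{0..L}. d\<^sup>2)"
    by (intro set_integral_mono bd borel_integrable_atLeastAtMost' continuous_intros contg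
        sine_poly_continuous[OF p]) (use L in auto)
  also have "\<dots> = d\<^sup>2 * L" using L by (simp add: set_lebesgue_integral_def)
  also have "\<dots> < \<epsilon>" by (rule d)
  finally show "\<exists>p. sine_poly L p \<and> (LBINT x:{0..L}. (sin (pi * x / L) * g x - p x)\<^sup>2) < \<epsilon>"
    using p by blast
qed

text \<open>Multiplication by a sine does not increase L2 distances, so the property passes from
  continuous functions to their limits.\<close>

lemma sine_approximable_sin_times:
  assumes f: "square_integrable_on {0..L} f" and L: "0 < L"
  shows "sine_approximable L (\<lambda>x. sin (pi * x / L) * f x)"
  using f
proof (induction rule: square_integrable_induct)
  case (continuous g)
  then show ?case using L by (rule sine_approximable_sin_times_continuous)
next
  case (add g h)
  then show ?case using sine_approximable_add[OF add] by (simp add: distrib_left)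
next
  case (scale c g)
  then show ?case using sine_approximable_scale[OF scale, of c] by (simp add: mult.left_commute)
next
  case (limit F g)
  have sin: "continuous_on {0..L} (\<lambda>x. sin (pi * x / L))" using L by (auto intro!: continuous_intros)
  note si = square_integrable_on_mult_continuous[OF _ sin]
  show ?case
  proof (rule sine_approximable_limit)
    show "sine_approximable L (\<lambda>x. sin (pi * x / L) * F i x)" for i by (rule limit)
    show "square_integrable_on {0..L} (\<lambda>x. sin (pi * x / L) * g x)" by (intro si limit)
    show "(\<lambda>i. LBINT x:{0..L}. (sin (pi * x / L) * F i x - sin (pi * x / L) * g x)\<^sup>2) \<longlonglongrightarrow> 0"
    proof (rule tendsto_sandwich[OF _ _ tendsto_const limit(4)])
      show "\<forall>\<^sub>F i in sequentially. 0 \<le> (LBINT x:{0..L}. (sin (pi * x / L) * F i x - sin (pi * x / L) * g x)\<^sup>2)"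
        by (simp add: set_lebesgue_integral_def integral_nonneg_AE)
      have "(a * b - a * c)\<^sup>2 \<le> (b - c)\<^sup>2" if "\<bar>a\<bar> \<le> 1" for a b c :: real
      proof -
        have "a\<^sup>2 * (b - c)\<^sup>2 \<le> 1 * (b - c)\<^sup>2"
          using that by (intro mult_right_mono) (auto simp: abs_square_le_1)
        then show ?thesis by (simp add: power_mult_distrib flip: right_diff_distrib)
      qed
      then show "\<forall>\<^sub>F i in sequentially. (LBINT x:{0..L}. (sin (pi * x / L) * F i x - sin (pi * x / L) * g x)\<^sup>2)
          \<le> (LBINT x:{0..L}. (F i x - g x)\<^sup>2)"
        by (intro always_eventually allI set_integral_mono square_integrable_set_integrable
            square_integrable_on_diff si limit) auto
    qed
  qed
qed

text \<open>The factor sine vanishes at both endpoints and cannot simply be divided out. Instead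
  \<open>f\<close> is multiplied by \<open>?h k\<close>, the reciprocal of \<open>?s\<close>
  truncated continuously at height \<open>k\<close>; at each interior point the product with
  \<open>?s\<close> equals 1 once \<open>k\<close> is large.\<close>

lemma sine_approximable_square_integrable:
  assumes f: "square_integrable_on {0..L} f" and L: "0 < L"
  shows "sine_approximable L f"
proof -
  let ?s = "\<lambda>x. sin (pi * x / L)"
  let ?h = "\<lambda>k x. real k / max 1 (real k * ?s x)"
  have conth: "continuous_on {0..L} (?h k)" for k
    using L by (auto intro!: continuous_intros)
  have sin: "continuous_on {0..L} ?s" using L by (auto intro!: continuous_intros)
  have spos: "?s x > 0" if "0 < x" "x < L" for x
    using that L by (intro sin_gt_zero) (auto simp: field_simps)
  have snn: "?s x \<ge> 0" if "x \<in> {0..L}" for x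
    using that L by (intro sin_ge_zero) (auto simp: field_simps)
  \<comment> \<open>\<open>?s * ?h k = min 1 (k * ?s)\<close> is a cutoff at the endpoints.\<close>
  have h01: "0 \<le> ?s x * ?h k x \<and> ?s x * ?h k x \<le> 1" if "x \<in> {0..L}" for x k
    using snn[OF that] by (auto simp: field_simps max_def)
  note s1 = square_integrable_on_mult_continuous[OF f conth]
  show ?thesis
  proof (rule sine_approximable_limit)
    show "sine_approximable L (\<lambda>x. ?s x * (?h k x * f x))" for k
      using s1 L by (rule sine_approximable_sin_times)
    show "(\<lambda>k. LBINT x:{0..L}. (?s x * (?h k x * f x) - f x)\<^sup>2) \<longlonglongrightarrow> 0"
    proof (rule square_integrable_dominated_convergence)
      show "square_integrable_on {0..L} (\<lambda>x. ?s x * (?h k x * f x))" for k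
        by (intro square_integrable_on_mult_continuous s1 sin)
      show "\<bar>?s x * (?h k x * f x) - f x\<bar> \<le> \<bar>f x\<bar>" if "x \<in> {0..L}" for k x
      proof -
        have "\<bar>?s x * ?h k x - 1\<bar> * \<bar>f x\<bar> \<le> 1 * \<bar>f x\<bar>"
          using h01[OF that, of k] by (intro mult_right_mono) auto
        then show ?thesis by (simp add: left_diff_distrib mult.assoc flip: abs_mult)
      qed
      have "AE x in lborel. x \<noteq> (0::real)" "AE x in lborel. x \<noteq> L"
        by (rule AE_lborel_singleton)+
      then show "AE x in lborel. x \<in> {0..L} \<longrightarrow> (\<lambda>k. ?s x * (?h k x * f x)) \<longlonglongrightarrow> f x"
      proof eventually_elim
        case (elim x)
        show ?case
        proof
          assume "x \<in> {0..L}"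
          with elim have s: "?s x > 0" by (intro spos) auto
          obtain K :: nat where K: "1 / ?s x < K" using reals_Archimedean2 by blast
          have "?s x * (?h k x * f x) = f x" if "k \<ge> K" for k
          proof -
            have "1 / ?s x < k" using K that by linarith
            then have "1 < real k * ?s x" using s by (simp add: field_simps)
            then show ?thesis using s by (auto simp: max_def)
          qed
          then have "\<forall>\<^sub>F k in sequentially. ?s x * (?h k x * f x) = f x"
            unfolding eventually_sequentially by blast
          then show "(\<lambda>k. ?s x * (?h k x * f x)) \<longlonglongrightarrow> f x" by (rule tendsto_eventually)
        qed
      qed
    qed (rule f)+
  qed (rule f)
qed

section \<open>Fractional powers as integrals of resolvents\<close>

text \<open>Scaling the variable by \<open>t\<close> exhibits the integral as
  \<open>t powr - \<alpha>\<close> times its value \<open>K\<close> at \<open>t = 1\<close>.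
  Classically K = pi / sin(pi \<alpha>); the constant cancels in the comparison, so positivity and
  finiteness are what matters.\<close>

lemma stieltjes_powr_integral:
  fixes \<alpha> :: real
  assumes "0 < \<alpha>" "\<alpha> < 1"
  obtains k where "0 < k"
    "\<And>t. 0 < t \<Longrightarrow> (\<integral>\<^sup>+s. ennreal (indicator {0<..} s * (s powr - \<alpha> / (t + s))) \<partial>lborel)
      = ennreal (k * t powr - \<alpha>)"
proof -
  define g :: "real \<Rightarrow> real \<Rightarrow> real" where "g t s = indicator {0<..} s * (s powr - \<alpha> / (t + s))" for t s
  have [measurable]: "g t \<in> borel_measurable borel" for t unfolding g_def by measurable
  define K where "K = (\<integral>\<^sup>+s. ennreal (g 1 s) \<partial>lborel)"
  have scale: "(\<integral>\<^sup>+s. ennreal (g t s) \<partial>lborel) = ennreal (t powr - \<alpha>) * K" if t: "0 < t" for t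
  proof -
    have "(\<integral>\<^sup>+s. ennreal (g t s) \<partial>lborel) = ennreal \<bar>t\<bar> * (\<integral>\<^sup>+s. ennreal (g t (0 + t * s)) \<partial>lborel)"
      using t by (intro nn_integral_real_affine) auto
    also have "\<dots> = ennreal t * (\<integral>\<^sup>+s. ennreal (t powr - \<alpha> / t) * ennreal (g 1 s) \<partial>lborel)"
    proof -
      have "ennreal (g t (0 + t * s)) = ennreal (t powr - \<alpha> / t) * ennreal (g 1 s)" for s
      proof (cases "0 < s")
        case True
        have "(t * s) powr - \<alpha> / (t + t * s) = t powr - \<alpha> / t * (s powr - \<alpha> / (1 + s))"
          using t True by (simp add: powr_mult field_simps)
        then show ?thesis
          using t True by (simp add: g_def flip: ennreal_mult)
      next
        case False
        then show ?thesis using t by (simp add: g_def zero_less_mult_iff)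
      qed
      then show ?thesis using t by simp
    qed
    also have "\<dots> = ennreal (t powr - \<alpha>) * K"
      using t by (simp add: nn_integral_cmult K_def flip: mult.assoc ennreal_mult)
    finally show ?thesis .
  qed
  \<comment> \<open>Finiteness of \<open>K\<close> takes both bounds on the exponent:
    \<open>\<alpha> < 1\<close> gives integrability at 0, and \<open>0 < \<alpha>\<close> at
    infinity.\<close>
  have i1: "(\<integral>\<^sup>+s. ennreal (indicator {0..1} s * s powr - \<alpha>) \<partial>lborel) < \<infinity>"
    using nn_integral_has_integral_lebesgue[OF _ has_integral_powr_from_0[of "- \<alpha>" 1]] assms
    by (simp add: nn_integral_completion)
  have i2: "(\<integral>\<^sup>+s. ennreal (indicator {1..} s * s powr (- \<alpha> - 1)) \<partial>lborel) < \<infinity>"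
    using nn_integral_has_integral_lebesgue[OF _ has_integral_powr_to_inf[of "- \<alpha> - 1" 1]] assms
    by (simp add: nn_integral_completion)
  have "K \<le> (\<integral>\<^sup>+s. ennreal (indicator {0..1} s * s powr - \<alpha>) + ennreal (indicator {1..} s * s powr (- \<alpha> - 1)) \<partial>lborel)"
    unfolding K_def
  proof (rule nn_integral_mono)
    fix s :: real
    consider "s \<le> 0" | "0 < s" "s \<le> 1" | "1 < s" by linarith
    then show "ennreal (g 1 s) \<le> ennreal (indicator {0..1} s * s powr - \<alpha>)
        + ennreal (indicator {1..} s * s powr (- \<alpha> - 1))"
    proof cases
      case 1
      then show ?thesis by (simp add: g_def)
    next
      case 2
      have "s powr - \<alpha> / (1 + s) \<le> s powr - \<alpha> / 1"
        using 2 by (intro divide_left_mono) auto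
      then have "ennreal (g 1 s) \<le> ennreal (s powr - \<alpha>)" using 2 by (simp add: g_def)
      then show ?thesis using 2 by (intro order_trans[OF _ add_increasing2]) auto
    next
      case 3
      have "s powr - \<alpha> / (1 + s) \<le> s powr - \<alpha> / s"
        using 3 by (intro divide_left_mono) auto
      also have "\<dots> = s powr (- \<alpha> - 1)" using 3 by (simp add: powr_diff)
      finally show ?thesis using 3 by (simp add: g_def)
    qed
  qed
  also have "\<dots> < \<infinity>" using i1 i2 by (subst nn_integral_add) auto
  finally have fin: "K < \<infinity>" .
  \<comment> \<open>On [1, 2] the integrand decreases, so its value at 2 bounds it from
    below.\<close>
  have "0 < ennreal (2 powr - \<alpha> / 3) * emeasure lborel {1..2::real}"
    by (simp add: ennreal_zero_less_mult_iff)
  also have "\<dots> = (\<integral>\<^sup>+s. ennreal (2 powr - \<alpha> / 3) * indicator {1..2::real} s \<partial>lborel)"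
    by (intro nn_integral_cmult_indicator[symmetric]) simp
  also have "\<dots> \<le> K"
    unfolding K_def
  proof (rule nn_integral_mono)
    fix s :: real
    have "2 powr - \<alpha> / 3 \<le> s powr - \<alpha> / (1 + s)" if "1 \<le> s" "s \<le> 2"
      using that assms powr_mono2'[of "- \<alpha>" s 2] by (intro frac_le) auto
    then show "ennreal (2 powr - \<alpha> / 3) * indicator {1..2} s \<le> ennreal (g 1 s)"
      by (auto simp: g_def indicator_def intro!: ennreal_leI)
  qed
  finally have pos: "0 < K" .
  show ?thesis
  proof (rule that[of "enn2real K"])
    show "0 < enn2real K" using pos fin by (simp add: enn2real_positive_iff)
    show "(\<integral>\<^sup>+s. ennreal (indicator {0<..} s * (s powr - \<alpha> / (t + s))) \<partial>lborel)
      = ennreal (enn2real K * t powr - \<alpha>)" if "0 < t" for t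
      using scale[OF that] fin by (simp add: g_def ennreal_mult mult.commute)
  qed
qed

text \<open>
  The function \<open>t \<mapsto> t powr - \<alpha>\<close> is a superposition of the functions \<open>t \<mapsto> 1 / (t + s)\<close>, which is the
  Loewner--Heinz argument for the operator monotonicity of fractional powers.
\<close>

lemma sum_powr_le_of_sum_resolvent_le:
  fixes a b \<nu> \<mu> :: "nat \<Rightarrow> real"
  assumes \<alpha>: "0 < \<alpha>" "\<alpha> < 1"
    and pos: "\<And>n. 0 \<le> a n" "\<And>n. 0 \<le> b n" "\<And>n. 0 < \<nu> n" "\<And>n. 0 < \<mu> n"
    and le: "\<And>s. 0 < s \<Longrightarrow> summable (\<lambda>m. b m / (\<mu> m + s)) \<and>
      (\<Sum>n<N. a n / (\<nu> n + s)) \<le> (\<Sum>m. b m / (\<mu> m + s))"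
    and summable: "summable (\<lambda>m. b m * \<mu> m powr - \<alpha>)"
  shows "(\<Sum>n<N. a n * \<nu> n powr - \<alpha>) \<le> (\<Sum>m. b m * \<mu> m powr - \<alpha>)"
proof -
  obtain k where k: "0 < k" and int:
    "\<And>t. 0 < t \<Longrightarrow> (\<integral>\<^sup>+s. ennreal (indicator {0<..} s * (s powr - \<alpha> / (t + s))) \<partial>lborel)
      = ennreal (k * t powr - \<alpha>)"
    using stieltjes_powr_integral[OF \<alpha>] by metis
  let ?g = "\<lambda>t s::real. indicator {0<..} s * (s powr - \<alpha> / (t + s))"
  have int': "(\<integral>\<^sup>+s. ennreal (c * ?g t s) \<partial>lborel) = ennreal (k * (c * t powr - \<alpha>))"
    if "0 \<le> c" "0 < t" for c t
  proof -
    have "ennreal (c * ?g t s) = ennreal c * ennreal (?g t s)" for s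
      using that by (intro ennreal_mult) (auto simp: indicator_def)
    then have "(\<integral>\<^sup>+s. ennreal (c * ?g t s) \<partial>lborel) = ennreal c * (\<integral>\<^sup>+s. ennreal (?g t s) \<partial>lborel)"
      by (simp only:) (rule nn_integral_cmult, simp)
    also have "\<dots> = ennreal c * ennreal (k * t powr - \<alpha>)"
      unfolding int[OF that(2)] ..
    also have "\<dots> = ennreal (k * (c * t powr - \<alpha>))"
      using that k by (simp add: mult.left_commute flip: ennreal_mult)
    finally show ?thesis .
  qed
  have g0: "0 \<le> c * ?g t s" if "0 \<le> c" "0 < t" for c t s
    using that by (auto simp: indicator_def)
  have sk: "summable (\<lambda>m. k * (b m * \<mu> m powr - \<alpha>))" using summable by (rule summable_mult)
  \<comment> \<open>All terms are non-negative, so in \<open>ennreal\<close> the interchange of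
    integral and infinite sum is monotone convergence. The constant \<open>k\<close> appears on both
    sides and is cancelled at the end.\<close>
  have "ennreal (\<Sum>n<N. k * (a n * \<nu> n powr - \<alpha>)) = (\<Sum>n<N. \<integral>\<^sup>+s. ennreal (a n * ?g (\<nu> n) s) \<partial>lborel)"
    using pos k unfolding int'[OF pos(1,3)] by simp
  also have "\<dots> = (\<integral>\<^sup>+s. (\<Sum>n<N. ennreal (a n * ?g (\<nu> n) s)) \<partial>lborel)"
    by (subst nn_integral_sum) auto
  also have "\<dots> \<le> (\<integral>\<^sup>+s. (\<Sum>m. ennreal (b m * ?g (\<mu> m) s)) \<partial>lborel)"
  proof (rule nn_integral_mono)
    fix s :: real
    show "(\<Sum>n<N. ennreal (a n * ?g (\<nu> n) s)) \<le> (\<Sum>m. ennreal (b m * ?g (\<mu> m) s))"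
    proof (cases "0 < s")
      case True
      have "(\<Sum>n<N. ennreal (a n * ?g (\<nu> n) s)) = ennreal (\<Sum>n<N. a n * ?g (\<nu> n) s)"
        using pos g0 by (intro sum_ennreal) auto
      also have "(\<Sum>n<N. a n * ?g (\<nu> n) s) = s powr - \<alpha> * (\<Sum>n<N. a n / (\<nu> n + s))"
        using True by (simp add: sum_distrib_left mult_ac)
      also have "ennreal \<dots> \<le> ennreal (s powr - \<alpha> * (\<Sum>m. b m / (\<mu> m + s)))"
        using le[OF True] by (intro ennreal_leI mult_left_mono) auto
      also have "s powr - \<alpha> * (\<Sum>m. b m / (\<mu> m + s)) = (\<Sum>m. s powr - \<alpha> * (b m / (\<mu> m + s)))"
        using le[OF True] by (intro suminf_mult[symmetric]) auto
      also have "ennreal \<dots> = (\<Sum>m. ennreal (s powr - \<alpha> * (b m / (\<mu> m + s))))"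
        using le[OF True] True pos less_imp_le[OF pos(4)]
        by (intro suminf_ennreal2[symmetric] summable_mult) auto
      also have "\<dots> = (\<Sum>m. ennreal (b m * ?g (\<mu> m) s))"
        using True by (simp add: mult_ac)
      finally show ?thesis .
    qed simp
  qed
  also have "\<dots> = (\<Sum>m. \<integral>\<^sup>+s. ennreal (b m * ?g (\<mu> m) s) \<partial>lborel)"
    by (intro nn_integral_suminf) auto
  also have "\<dots> = (\<Sum>m. ennreal (k * (b m * \<mu> m powr - \<alpha>)))"
    unfolding int'[OF pos(2,4)] ..
  also have "\<dots> = ennreal (\<Sum>m. k * (b m * \<mu> m powr - \<alpha>))"
    using pos k by (intro suminf_ennreal2 sk) auto
  finally have "(\<Sum>n<N. k * (a n * \<nu> n powr - \<alpha>)) \<le> (\<Sum>m. k * (b m * \<mu> m powr - \<alpha>))"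
    using suminf_nonneg[OF sk] pos k by (subst (asm) ennreal_le_iff) auto
  then show ?thesis
    using k summable by (simp add: suminf_mult flip: sum_distrib_left)
qed

section \<open>The loop\<close>

lemma LBINT_FTC:
  fixes f F :: "real \<Rightarrow> real"
  assumes "a \<le> b" "\<And>x. x \<in> {a..b} \<Longrightarrow> (F has_real_derivative f x) (at x within {a..b})"
    and "continuous_on {a..b} f"
  shows "(LBINT x:{a..b}. f x) = F b - F a"
  unfolding set_lebesgue_integral_def
  using assms by (intro integral_FTC_atLeastAtMost) (auto simp: has_real_derivative_iff_has_vector_derivative)

lemma eigenbasis_pos:
  assumes "eigenbasis G lam \<phi>"
  shows "0 < lam n"
proof -
  have "0 < lam 0" "incseq lam" using assms by (auto simp: eigenbasis_def)
  then show ?thesis using incseqD[of lam 0 n] by simp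
qed

lemma torsion_function_solves:
  assumes "\<exists>u. frac_laplacian \<alpha> G u (\<lambda>e x. 1)"
  shows "frac_laplacian \<alpha> G (torsion_function \<alpha> G) (\<lambda>e x. 1)"
proof -
  have "torsion_function \<alpha> G = (SOME u. frac_laplacian \<alpha> G u (\<lambda>e x. 1))"
    unfolding torsion_function_def using assms by (rule if_P)
  then show ?thesis using someI_ex[OF assms] by (simp only:)
qed

section \<open>Orthonormal bases and the spectral formula for the rigidity\<close>

context metric_graph
begin

text \<open>Completing the square in the coefficients, as in \<open>norm\<close>, shows that the
  Fourier coefficients \<open>?d\<close> give the best approximation of each length. Approximations
  with any coefficients, even varying with \<open>M\<close>, therefore force the Fourier series to
  converge.\<close>

lemma orthonormal_basisI:
  assumes \<phi>: "\<And>n. \<phi> n \<in> L2 G"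
    and orth: "\<And>m n. L2_inner G (\<phi> m) (\<phi> n) = (if m = n then 1 else 0)"
    and dense: "\<And>f \<epsilon>. f \<in> L2 G \<Longrightarrow> 0 < \<epsilon> \<Longrightarrow> \<exists>N. \<forall>M\<ge>N. \<exists>c.
      L2_inner G (\<lambda>e x. f e x - (\<Sum>n<M. c n * \<phi> n e x)) (\<lambda>e x. f e x - (\<Sum>n<M. c n * \<phi> n e x)) < \<epsilon>"
  shows "orthonormal_basis G \<phi>"
  unfolding orthonormal_basis_def
proof (intro conjI allI ballI \<phi> orth)
  fix f assume f: "f \<in> L2 G"
  let ?d = "\<lambda>n. L2_inner G f (\<phi> n)"
  let ?r = "\<lambda>c M e x. f e x - (\<Sum>n<M. c n * \<phi> n e x)"
  have norm: "L2_inner G (?r c M) (?r c M) = L2_inner G f f - (\<Sum>n<M. (?d n)\<^sup>2) + (\<Sum>n<M. (c n - ?d n)\<^sup>2)" for c M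
  proof -
    let ?q = "\<lambda>e x. \<Sum>n<M. c n * \<phi> n e x"
    have q: "?q \<in> L2 G" by (intro L2_sum L2_scale \<phi>)
    have 1: "L2_inner G f ?q = (\<Sum>n<M. c n * ?d n)"
      using f \<phi> L2_scale by (subst L2_inner_sum_right) (auto simp: L2_inner_scale_right)
    have 2: "L2_inner G ?q (\<phi> m) = c m" if "m < M" for m
    proof -
      have "L2_inner G ?q (\<phi> m) = (\<Sum>n<M. c n * (if n = m then 1 else 0))"
        using \<phi> L2_scale by (subst L2_inner_sum_left) (auto simp: L2_inner_scale_left orth)
      then show ?thesis using that by (simp add: if_distrib cong: if_cong)
    qed
    have "L2_inner G ?q ?q = (\<Sum>n<M. c n * L2_inner G ?q (\<phi> n))"
      using q \<phi> L2_scale by (subst L2_inner_sum_right) (auto simp: L2_inner_scale_right)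
    also have "\<dots> = (\<Sum>n<M. (c n)\<^sup>2)" by (intro sum.cong) (auto simp: 2 power2_eq_square)
    finally show ?thesis
      using L2_inner_diff_diff[OF f q] 1
      by (simp add: power2_diff sum.distrib sum_subtractf sum_distrib_left mult.assoc mult.left_commute)
  qed
  have "(\<lambda>M. L2_inner G (?r ?d M) (?r ?d M)) \<longlonglongrightarrow> 0"
  proof (rule LIMSEQ_I)
    fix \<epsilon> :: real assume "0 < \<epsilon>"
    then obtain N where N: "\<And>M. M \<ge> N \<Longrightarrow> \<exists>c. L2_inner G (?r c M) (?r c M) < \<epsilon>"
      using dense[OF f] by blast
    have "norm (L2_inner G (?r ?d M) (?r ?d M) - 0) < \<epsilon>" if "M \<ge> N" for M
    proof -
      obtain c where c: "L2_inner G (?r c M) (?r c M) < \<epsilon>" using N[OF \<open>M \<ge> N\<close>] by blast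
      have "L2_inner G (?r ?d M) (?r ?d M) \<le> L2_inner G (?r c M) (?r c M)"
        unfolding norm by (simp add: sum_nonneg)
      then show ?thesis using c L2_inner_nonneg[of "?r ?d M"] by simp
    qed
    then show "\<exists>N. \<forall>M\<ge>N. norm (L2_inner G (?r ?d M) (?r ?d M) - 0) < \<epsilon>" by blast
  qed
  from tendsto_real_sqrt[OF this] show "L2_sums G (\<lambda>n e x. ?d n * \<phi> n e x) f"
    by (simp add: L2_sums_def L2_norm_def)
qed

lemma graph_integral_eq_inner: "graph_integral G f = L2_inner G f (\<lambda>e x. 1)"
  by (simp add: L2_inner_def)

text \<open>Pairing the expansion of 1 with \<open>\<phi> k\<close> determines the coefficients of
  \<open>u\<close>; Parseval for \<open>u\<close> and 1 then yields the spectral formula. The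
  eigenbasis is whichever one witnesses \<open>frac_laplacian\<close>.\<close>

lemma frac_laplacian_one_sums:
  assumes "frac_laplacian \<alpha> G u (\<lambda>e x. 1)"
  obtains lam \<phi> where "eigenbasis G lam \<phi>"
    "(\<lambda>n. (L2_inner G (\<lambda>e x. 1) (\<phi> n))\<^sup>2 * lam n powr - \<alpha>) sums graph_integral G u"
proof -
  obtain lam \<phi> where u: "u \<in> L2 G" and eb: "eigenbasis G lam \<phi>"
    and s: "L2_sums G (\<lambda>n e x. lam n powr \<alpha> * L2_inner G u (\<phi> n) * \<phi> n e x) (\<lambda>e x. 1)"
    using assms unfolding frac_laplacian_def by blast
  have ob: "orthonormal_basis G \<phi>" using eb by (simp add: eigenbasis_def)
  then have \<phi>: "\<phi> n \<in> L2 G" for n by (simp add: orthonormal_basis_def)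
  have pos: "0 < lam n" for n by (rule eigenbasis_pos[OF eb])
  have a: "L2_inner G (\<lambda>e x. 1) (\<phi> k) = lam k powr \<alpha> * L2_inner G u (\<phi> k)" for k
  proof -
    have "(\<lambda>n. L2_inner G (\<lambda>e x. lam n powr \<alpha> * L2_inner G u (\<phi> n) * \<phi> n e x) (\<phi> k))
        sums L2_inner G (\<lambda>e x. 1) (\<phi> k)"
      by (rule L2_sums_inner[OF s L2_scale[OF \<phi>] L2_const \<phi>])
    moreover have "(\<lambda>n. L2_inner G (\<lambda>e x. lam n powr \<alpha> * L2_inner G u (\<phi> n) * \<phi> n e x) (\<phi> k))
        = (\<lambda>n. if n = k then lam k powr \<alpha> * L2_inner G u (\<phi> k) else 0)"
      using ob by (auto simp: L2_inner_scale_left orthonormal_basis_def)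
    moreover have "(\<lambda>n. if n = k then lam k powr \<alpha> * L2_inner G u (\<phi> k) else 0)
        sums (lam k powr \<alpha> * L2_inner G u (\<phi> k))"
      by (rule sums_single)
    ultimately show ?thesis by (simp add: sums_unique2)
  qed
  have "(\<lambda>n. L2_inner G u (\<phi> n) * L2_inner G (\<lambda>e x. 1) (\<phi> n)) sums L2_inner G u (\<lambda>e x. 1)"
    by (rule orthonormal_basis_parseval[OF ob u L2_const])
  moreover have "L2_inner G u (\<phi> n) * L2_inner G (\<lambda>e x. 1) (\<phi> n)
      = (L2_inner G (\<lambda>e x. 1) (\<phi> n))\<^sup>2 * lam n powr - \<alpha>" for n
    using pos[of n] by (simp add: a power2_eq_square powr_minus field_simps)
  ultimately show ?thesis using that eb by (simp add: graph_integral_eq_inner)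
qed

end

section \<open>The one-vertex loop and its topology\<close>

definition loop_graph :: "real \<Rightarrow> (nat, nat) metric_graph" where
  "loop_graph L = \<lparr>skel = \<lparr>verts = {0}, arcs = {0}, tail = \<lambda>_. 0, head = \<lambda>_. 0\<rparr>,
     len = \<lambda>_. L, dirichlet = {0}\<rparr>"

lemma loop_graph_simps [simp]:
  "edges (loop_graph L) = {0}" "vertices (loop_graph L) = {0}" "len (loop_graph L) e = L"
  "tail (skel (loop_graph L)) e = 0" "head (skel (loop_graph L)) e = 0" "dirichlet (loop_graph L) = {0}"
  by (simp_all add: loop_graph_def)

lemma metric_graph_loop_graph: "0 < L \<Longrightarrow> metric_graph (loop_graph L)"
  by unfold_locales auto

lemma total_length_loop_graph: "total_length (loop_graph L) = L"
  by (simp add: total_length_def)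

lemma L2_loop_graph: "f \<in> L2 (loop_graph L) \<longleftrightarrow> square_integrable_on {0..L} (f 0)"
  by (simp add: L2_def)

lemma L2_inner_loop_graph: "L2_inner (loop_graph L) f g = (LBINT x:{0..L}. f 0 x * g 0 x)"
  by (simp add: L2_inner_def graph_integral_def)

text \<open>The map x -> exp(2 pi i x / L) respects the gluing and is a bijection onto the circle,
  and a continuous bijection from a compact to a Hausdorff space is a homeomorphism. Compactness
  holds because the graph space is the continuous image of \<open>{0..L}\<close> under
  \<open>point\<close>.\<close>

lemma cycle_graph_loop_graph:
  assumes L: "0 < L"
  shows "cycle_graph (loop_graph L)"
proof -
  let ?C = "loop_graph L"
  let ?X = "graph_space ?C"
  let ?S = "sphere (0::complex) 1"
  have pts: "points ?C = insert (Inl 0) (Inr ` ({0} \<times> {0<..<L}))"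
    by (auto simp: points_def)
  have pointC: "point ?C 0 x = (if x = 0 \<or> x = L then Inl 0 else Inr (0, x))" for x
    by (simp add: point_def)
  have top: "topspace ?X = points ?C"
  proof
    show "topspace ?X \<subseteq> points ?C"
      using openin_topspace[of ?X] by (simp only: openin_graph_space)
    have "{x \<in> {0..L}. point ?C 0 x \<in> points ?C} = {0..L}" using L by (auto simp: pts pointC)
    then have "openin ?X (points ?C)" by (simp add: openin_graph_space)
    then show "points ?C \<subseteq> topspace ?X" by (rule openin_subset)
  qed
  have contp: "continuous_map (top_of_set {0..L}) ?X (point ?C 0)"
    unfolding continuous_map_def
  proof (intro conjI allI impI)
    show "point ?C 0 \<in> topspace (top_of_set {0..L}) \<rightarrow> topspace ?X"
      using L by (auto simp: top pts pointC)
    show "openin (top_of_set {0..L}) {x \<in> topspace (top_of_set {0..L}). point ?C 0 x \<in> U}"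
      if "openin ?X U" for U
      using that by (simp add: openin_graph_space)
  qed
  have img: "point ?C 0 ` {0..L} = points ?C"
  proof (intro equalityI subsetI)
    fix p assume "p \<in> points ?C"
    then consider "p = Inl 0" | x where "p = Inr (0, x)" "0 < x" "x < L" by (auto simp: pts)
    then show "p \<in> point ?C 0 ` {0..L}"
    proof cases
      case 1
      then show ?thesis using L by (intro image_eqI[of _ _ 0]) (auto simp: pointC)
    next
      case 2
      then show ?thesis by (intro image_eqI[of _ _ x]) (auto simp: pointC)
    qed
  qed (use L in \<open>auto simp: pts pointC\<close>)
  have comp: "compact_space ?X"
    using image_compactin[OF _ contp, of "{0..L}"] img
    by (simp add: compact_space_def top compactin_subtopology)
  define f :: "nat + nat \<times> real \<Rightarrow> complex" where
    "f p = (case p of Inl _ \<Rightarrow> 1 | Inr (_, x) \<Rightarrow> cis (2 * pi * x / L))" for p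
  have fp: "f (point ?C 0 x) = cis (2 * pi * x / L)" for x
    using L by (auto simp: f_def pointC)
  have contf: "continuous_map ?X (top_of_set ?S) f"
    unfolding continuous_map_def
  proof (intro conjI allI impI)
    show "f \<in> topspace ?X \<rightarrow> topspace (top_of_set ?S)"
      by (auto simp: f_def split: sum.splits prod.splits)
    fix U assume "openin (top_of_set ?S) U"
    then obtain T where T: "open T" "U = ?S \<inter> T" by (auto simp: openin_open)
    have "continuous_on {0..L} (\<lambda>x. cis (2 * pi * x / L))"
      using L by (auto intro!: continuous_intros)
    then have "openin (top_of_set {0..L}) ({0..L} \<inter> (\<lambda>x. cis (2 * pi * x / L)) -` T)"
      using T(1) by (rule continuous_openin_preimage_gen)
    also have "{0..L} \<inter> (\<lambda>x. cis (2 * pi * x / L)) -` T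
        = {x \<in> {0..L}. point ?C 0 x \<in> {p \<in> points ?C. f p \<in> U}}"
      using img by (auto simp: fp T(2))
    finally show "openin ?X {p \<in> topspace ?X. f p \<in> U}"
      unfolding top openin_graph_space by simp
  qed
  have "f ` points ?C = (\<lambda>x. cis (2 * pi * x / L)) ` {0..L}"
    unfolding img[symmetric] image_image fp ..
  also have "\<dots> = ?S"
  proof (intro equalityI subsetI)
    fix z :: complex assume "z \<in> ?S"
    then obtain t where t: "0 \<le> t" "t < 2 * pi" "z = cis t"
      using complex_norm_eq_1_exp[of z] Arg2pi_ge_0[of z] Arg2pi_lt_2pi[of z] Arg2pi_eq[of z]
      by (metis cis_conv_exp mem_sphere_0 mult_1 norm_one of_real_1)
    then show "z \<in> (\<lambda>x. cis (2 * pi * x / L)) ` {0..L}"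
      using L by (intro image_eqI[of _ _ "t * L / (2 * pi)"]) (auto simp: field_simps)
  qed auto
  finally have surj: "f ` points ?C = ?S" .
  have inj: "inj_on f (points ?C)"
  proof -
    have ne1: "cis (2 * pi * x / L) \<noteq> 1" if "0 < x" "x < L" for x
    proof
      assume "cis (2 * pi * x / L) = 1"
      then have "cos (2 * pi * x / L) = 1" by (simp add: complex_eq_iff)
      then obtain n :: int where "2 * pi * x / L = n * (2 * pi)"
        by (auto simp: cos_one_2pi_int)
      then have "x = n * L" using L by (simp add: field_simps)
      with that L have "0 < n" "n < 1" by (simp_all add: zero_less_mult_iff)
      then show False by simp
    qed
    have eqx: "x = y" if "cis (2 * pi * x / L) = cis (2 * pi * y / L)"
      "0 < x" "x < L" "0 < y" "y < L" "x \<le> y" for x y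
    proof (rule ccontr)
      assume "x \<noteq> y"
      then have "cis (2 * pi * (y - x) / L) \<noteq> 1" using that by (intro ne1) auto
      moreover have "cis (2 * pi * (y - x) / L) = cis (2 * pi * y / L) / cis (2 * pi * x / L)"
        by (simp add: cis_divide diff_divide_distrib right_diff_distrib)
      ultimately show False using that by simp
    qed
    show ?thesis
    proof (rule inj_onI)
      fix p q assume *: "p \<in> points ?C" "q \<in> points ?C" "f p = f q"
      from *(1,2) consider "p = Inl 0" "q = Inl 0"
        | x where "p = Inl 0" "q = Inr (0, x)" "0 < x" "x < L"
        | x where "q = Inl 0" "p = Inr (0, x)" "0 < x" "x < L"
        | x y where "p = Inr (0, x)" "q = Inr (0, y)" "0 < x" "x < L" "0 < y" "y < L"
        by (auto simp: pts)
      then show "p = q"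
      proof cases
        case (2 x)
        then show ?thesis using *(3) ne1[of x] by (simp add: f_def)
      next
        case (3 x)
        then show ?thesis using *(3) ne1[of x] by (simp add: f_def)
      next
        case (4 x y)
        then show ?thesis using *(3) eqx[of x y] eqx[of y x] by (cases "x \<le> y") (auto simp: f_def)
      qed simp
    qed
  qed
  have "homeomorphic_map ?X (top_of_set ?S) f"
    by (rule continuous_imp_homeomorphic_map[OF contf comp])
      (auto simp: Hausdorff_space_subtopology top surj inj)
  then show ?thesis
    unfolding cycle_graph_def using metric_graph_loop_graph[OF L] homeomorphic_map_imp_homeomorphic_space by blast
qed

section \<open>Spectrum of the loop, which is that of the Dirichlet Laplacian on
  \<open>[0, L]\<close>\<close>

definition sine_eigenvalue :: "real \<Rightarrow> nat \<Rightarrow> real" where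
  "sine_eigenvalue L n = (real (Suc n) * pi / L)\<^sup>2"

definition sine_eigenfunction :: "real \<Rightarrow> nat \<Rightarrow> nat graph_fun" where
  "sine_eigenfunction L n e x = sqrt (2 / L) * sin (real (Suc n) * pi * x / L)"

lemma sine_eigenfunction_continuous: "0 < L \<Longrightarrow> continuous_on A (sine_eigenfunction L n e)"
  unfolding sine_eigenfunction_def by (intro continuous_intros) auto

text \<open>Integer frequencies, because the product of two sines involves the difference of their
  frequencies as well as the sum.\<close>

lemma LBINT_cos_multiple:
  fixes j :: int
  assumes L: "0 < L"
  shows "(LBINT x:{0..L}. cos (j * pi * x / L)) = (if j = 0 then L else 0)"
proof (cases "j = 0")
  case True
  then show ?thesis using L by (simp add: set_lebesgue_integral_def)
next
  case False
  have s: "sin (real_of_int j * pi) = 0" by (auto simp: sin_zero_iff_int2)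
  have "(LBINT x:{0..L}. cos (j * pi * x / L)) = L / (j * pi) * sin (j * pi * L / L) - L / (j * pi) * sin (j * pi * 0 / L)"
    using L False
    by (intro LBINT_FTC) (auto intro!: derivative_eq_intros continuous_intros)
  then show ?thesis using L False s by simp
qed

lemma sine_eigenfunction_orthonormal:
  assumes L: "0 < L"
  shows "L2_inner (loop_graph L) (sine_eigenfunction L m) (sine_eigenfunction L n) = (if m = n then 1 else 0)"
proof -
  let ?c = "\<lambda>(j::int) x. cos (j * pi * x / L)"
  have int: "set_integrable lborel {0..L} (?c j)" for j
    using L by (intro borel_integrable_atLeastAtMost' continuous_intros) auto
  \<comment> \<open>The summand 2 stems from the two \<open>Suc\<close>. The sum frequency is thus
    positive and its cosine integrates to 0; the difference frequency contributes exactly when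
    \<open>m = n\<close>.\<close>
  have "sine_eigenfunction L m 0 x * sine_eigenfunction L n 0 x
      = (1 / L) * (?c (int m - int n) x - ?c (int m + int n + 2) x)" for x
  proof -
    have e: "(int m - int n) * pi * x / L = real (Suc m) * pi * x / L - real (Suc n) * pi * x / L"
      "(int m + int n + 2) * pi * x / L = real (Suc m) * pi * x / L + real (Suc n) * pi * x / L"
      by (simp_all add: algebra_simps add_divide_distrib diff_divide_distrib)
    have s: "sqrt (2 / L) * a * (sqrt (2 / L) * b) = 2 / L * (a * b)" for a b
    proof -
      have "sqrt (2 / L) * a * (sqrt (2 / L) * b) = (sqrt (2 / L) * sqrt (2 / L)) * (a * b)"
        by (simp only: mult_ac)
      also have "sqrt (2 / L) * sqrt (2 / L) = 2 / L" using L by (simp only: real_sqrt_mult_self) simp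
      finally show ?thesis .
    qed
    show ?thesis
      unfolding sine_eigenfunction_def e cos_add cos_diff s by simp
  qed
  then have "L2_inner (loop_graph L) (sine_eigenfunction L m) (sine_eigenfunction L n)
      = (1 / L) * ((LBINT x:{0..L}. ?c (int m - int n) x) - (LBINT x:{0..L}. ?c (int m + int n + 2) x))"
    unfolding L2_inner_loop_graph by (simp only: set_integral_mult_right set_integral_diff[OF int int])
  then show ?thesis
    using L unfolding LBINT_cos_multiple[OF L] by auto
qed

lemma sine_eigenfunction_basis:
  assumes L: "0 < L"
  shows "orthonormal_basis (loop_graph L) (sine_eigenfunction L)"
proof (rule metric_graph.orthonormal_basisI[OF metric_graph_loop_graph[OF L]])
  show "sine_eigenfunction L n \<in> L2 (loop_graph L)" for n
    unfolding L2_loop_graph by (intro square_integrable_on_continuous sine_eigenfunction_continuous L)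
  fix f :: "nat graph_fun" and \<epsilon> :: real
  assume f: "f \<in> L2 (loop_graph L)" and e: "0 < \<epsilon>"
  then obtain p where p: "sine_poly L p" "(LBINT x:{0..L}. (f 0 x - p x)\<^sup>2) < \<epsilon>"
    using sine_approximable_square_integrable[OF _ L] unfolding L2_loop_graph sine_approximable_def by blast
  obtain N c where N: "\<And>M. M \<ge> N \<Longrightarrow> p = (\<lambda>x. \<Sum>n<M. c n * sin (real (Suc n) * pi * x / L))"
    using sine_poly_coefficients[OF p(1)] by blast
  have "(\<Sum>n<M. c n / sqrt (2 / L) * sine_eigenfunction L n 0 x) = p x" if "M \<ge> N" for M x
    using L unfolding N[OF that] sine_eigenfunction_def by (intro sum.cong) auto
  then show "\<exists>N. \<forall>M\<ge>N. \<exists>c. L2_inner (loop_graph L)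
      (\<lambda>e x. f e x - (\<Sum>n<M. c n * sine_eigenfunction L n e x))
      (\<lambda>e x. f e x - (\<Sum>n<M. c n * sine_eigenfunction L n e x)) < \<epsilon>"
    using p(2) unfolding L2_inner_loop_graph
    by (intro exI[of _ N] allI impI exI[of _ "\<lambda>n. c n / sqrt (2 / L)"]) (simp add: power2_eq_square)
qed (rule sine_eigenfunction_orthonormal[OF L])

lemma neg_laplacian_sine_eigenfunction:
  assumes L: "0 < L"
  shows "neg_laplacian (loop_graph L) (sine_eigenfunction L n)
    (\<lambda>e x. sine_eigenvalue L n * sine_eigenfunction L n e x)"
proof -
  define k where "k = real (Suc n) * pi / L"
  have \<phi>: "sine_eigenfunction L n e = (\<lambda>x. sqrt (2 / L) * sin (k * x))" for e
    by (auto simp: sine_eigenfunction_def k_def)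
  define d :: "nat graph_fun" where "d = (\<lambda>e x. sqrt (2 / L) * k * cos (k * x))"
  have end0: "sin (k * L) = 0"
    using L sin_npi[of "Suc n"] by (simp add: k_def)
  have "H2_on L (sine_eigenfunction L n e) (d e) (\<lambda>x. - (sine_eigenvalue L n * sine_eigenfunction L n e x))" for e
    unfolding H2_on_def
  proof (intro conjI ballI)
    show "(sine_eigenfunction L n e has_real_derivative d e x) (at x within {0..L})" for x
      unfolding \<phi> d_def by (auto intro!: derivative_eq_intros)
    show "square_integrable_on {0..L} (\<lambda>x. - (sine_eigenvalue L n * sine_eigenfunction L n e x))"
      by (intro square_integrable_on_continuous continuous_intros sine_eigenfunction_continuous L)
    show "d e x = d e 0 + (LBINT y:{0..x}. - (sine_eigenvalue L n * sine_eigenfunction L n e y))"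
      if "x \<in> {0..L}" for x
    proof -
      have "(LBINT y:{0..x}. - (sine_eigenvalue L n * sine_eigenfunction L n e y)) = d e x - d e 0"
      proof (rule LBINT_FTC)
        show "(d e has_real_derivative - (sine_eigenvalue L n * sine_eigenfunction L n e y)) (at y within {0..x})" for y
          unfolding \<phi> d_def sine_eigenvalue_def k_def[symmetric]
          by (auto intro!: derivative_eq_intros simp: power2_eq_square)
        show "continuous_on {0..x} (\<lambda>y. - (sine_eigenvalue L n * sine_eigenfunction L n e y))"
          by (intro continuous_intros sine_eigenfunction_continuous L)
      qed (use that in auto)
      then show ?thesis by simp
    qed
  qed
  \<comment> \<open>As the single vertex is Dirichlet, the vertex values are 0 and the Kirchhoff
    condition ranges over the empty set.\<close>
  then show ?thesis
    unfolding neg_laplacian_def vertex_conditions_def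
    by (intro exI[of _ d] conjI exI[of _ "\<lambda>_. 0"]) (auto simp: \<phi> end0)
qed

lemma eigenbasis_sine:
  assumes L: "0 < L"
  shows "eigenbasis (loop_graph L) (sine_eigenvalue L) (sine_eigenfunction L)"
  unfolding eigenbasis_def
proof (intro conjI allI sine_eigenfunction_basis neg_laplacian_sine_eigenfunction L)
  show "0 < sine_eigenvalue L 0" using L by (simp add: sine_eigenvalue_def)
  show "incseq (sine_eigenvalue L)"
    unfolding sine_eigenvalue_def using L
    by (intro monoI power_mono divide_right_mono mult_right_mono) auto
  have "filterlim (\<lambda>n. real (Suc n)) at_top sequentially"
    using filterlim_real_sequentially filterlim_Suc by (rule filterlim_compose)
  then have "filterlim (\<lambda>n. pi / L * real (Suc n)) at_top sequentially"
    using L by (intro filterlim_tendsto_pos_mult_at_top[OF tendsto_const]) auto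
  then have "filterlim (\<lambda>n. (pi / L * real (Suc n))\<^sup>2) at_top sequentially"
    by (intro filterlim_pow_at_top) auto
  then show "filterlim (sine_eigenvalue L) at_top sequentially"
    unfolding sine_eigenvalue_def by (simp add: mult.commute[of pi])
qed

text \<open>Decay of order 1/n, combined with the factor
  \<open>sine_eigenvalue L n powr - \<alpha>\<close>, makes the series of the torsion function
  uniformly convergent for every \<open>\<alpha> > 0\<close>.\<close>

lemma sine_coefficient_one:
  assumes L: "0 < L"
  shows "\<bar>L2_inner (loop_graph L) (\<lambda>e x. 1) (sine_eigenfunction L n)\<bar>
    \<le> 2 * sqrt (2 / L) / (real (Suc n) * pi / L)"
proof -
  define k where "k = real (Suc n) * pi / L"
  have k: "0 < k" using L by (simp add: k_def)
  have \<phi>: "sine_eigenfunction L n e = (\<lambda>x. sqrt (2 / L) * sin (k * x))" for e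
    by (auto simp: sine_eigenfunction_def k_def)
  have "(LBINT x:{0..L}. sin (k * x)) = - cos (k * L) / k - - cos (k * 0) / k"
    using L k by (intro LBINT_FTC) (auto intro!: derivative_eq_intros continuous_intros)
  also have "\<dots> = (1 - cos (k * L)) / k" by (simp add: diff_divide_distrib)
  also have "\<bar>\<dots>\<bar> \<le> 2 / k"
    using k cos_le_one[of "k * L"] cos_ge_minus_one[of "k * L"]
    by (simp add: divide_right_mono)
  finally have "sqrt (2 / L) * \<bar>LBINT x:{0..L}. sin (k * x)\<bar> \<le> sqrt (2 / L) * (2 / k)"
    using L by (intro mult_left_mono) auto
  then show ?thesis
    using L by (simp add: L2_inner_loop_graph \<phi> abs_mult k_def mult_ac)
qed

text \<open>The solution is explicit: its sine series converges uniformly by the Weierstrass test,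
  so the sum is continuous, hence square integrable, and L2 convergence returns the prescribed
  coefficients.\<close>

lemma frac_laplacian_loop_graph_exists:
  assumes L: "0 < L" and \<alpha>: "0 < \<alpha>"
  shows "\<exists>u. frac_laplacian \<alpha> (loop_graph L) u (\<lambda>e x. 1)"
proof -
  interpret metric_graph "loop_graph L" by (rule metric_graph_loop_graph[OF L])
  let ?C = "loop_graph L" and ?\<phi> = "sine_eigenfunction L" and ?lam = "sine_eigenvalue L"
  have ob: "orthonormal_basis ?C ?\<phi>" by (rule sine_eigenfunction_basis[OF L])
  then have \<phi>: "?\<phi> n \<in> L2 ?C" for n by (simp add: orthonormal_basis_def)
  have lampos: "0 < ?lam n" for n using L by (simp add: sine_eigenvalue_def)
  define b where "b n = L2_inner ?C (\<lambda>e x. 1) (?\<phi> n)" for n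
  define c where "c n = ?lam n powr - \<alpha> * b n" for n
  \<comment> \<open>The majorant collects the power - 2 * \<alpha> of the frequency from the
    eigenvalue, the power - 1 and a factor \<open>2 * sqrt (2 / L)\<close> from the coefficient of
    1, and another \<open>sqrt (2 / L)\<close> from the eigenfunction.\<close>
  define w where "w n = 4 / L * (pi / L) powr (- 2 * \<alpha> - 1) * real (Suc n) powr (- 2 * \<alpha> - 1)" for n
  have bound: "\<bar>c n * ?\<phi> n e x\<bar> \<le> w n" for n e x
  proof -
    define k where "k = real (Suc n) * pi / L"
    have k: "0 < k" using L by (simp add: k_def)
    have lam: "?lam n powr - \<alpha> = k powr (- 2 * \<alpha>)"
    proof -
      have "?lam n = k powr 2" using k by (simp add: sine_eigenvalue_def k_def)
      then show ?thesis by (simp add: powr_powr)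
    qed
    have "\<bar>?\<phi> n e x\<bar> \<le> sqrt (2 / L) * 1"
      unfolding sine_eigenfunction_def abs_mult using L by (intro mult_mono) auto
    then have "\<bar>c n * ?\<phi> n e x\<bar> \<le> (k powr (- 2 * \<alpha>) * (2 * sqrt (2 / L) / k)) * (sqrt (2 / L) * 1)"
      unfolding c_def abs_mult lam b_def
      using sine_coefficient_one[OF L, of n] k L
      by (intro mult_mono mult_nonneg_nonneg) (auto simp: k_def)
    also have "\<dots> = 2 * (sqrt (2 / L) * sqrt (2 / L)) * (k powr (- 2 * \<alpha>) / k)"
      by (simp only: mult_ac times_divide_eq_right times_divide_eq_left mult_1_right)
    also have "\<dots> = 4 / L * (k powr (- 2 * \<alpha>) / k)"
      using L unfolding real_sqrt_mult_self by simp
    also have "k powr (- 2 * \<alpha>) / k = k powr (- 2 * \<alpha> - 1)"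
      using k by (simp add: powr_diff)
    also have "k powr (- 2 * \<alpha> - 1) = (pi / L) powr (- 2 * \<alpha> - 1) * real (Suc n) powr (- 2 * \<alpha> - 1)"
      using L unfolding k_def by (subst powr_mult[symmetric]) (auto simp: mult.commute)
    finally show ?thesis by (simp add: w_def mult.assoc)
  qed
  have "summable (\<lambda>n. real n powr (- 2 * \<alpha> - 1))"
    using \<alpha> by (simp add: summable_real_powr_iff)
  then have "summable (\<lambda>n. real (Suc n) powr (- 2 * \<alpha> - 1))"
    by (simp only: summable_Suc_iff[of "\<lambda>n. real n powr (- 2 * \<alpha> - 1)"])
  then have sw: "summable w"
    unfolding w_def by (rule summable_mult)
  have sc: "summable (\<lambda>n. c n * ?\<phi> n e x)" for e x
    using bound by (intro summable_comparison_test'[OF sw]) auto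
  define u :: "nat graph_fun" where "u e x = (\<Sum>n. c n * ?\<phi> n e x)" for e x
  have cont: "continuous_on {0..L} (\<lambda>x. \<Sum>n<N. c n * ?\<phi> n e x)" for N e
    by (intro continuous_intros sine_eigenfunction_continuous L)
  have ul: "uniform_limit {0..L} (\<lambda>N x. \<Sum>n<N. c n * ?\<phi> n 0 x) (u 0) sequentially"
    unfolding u_def using bound by (intro Weierstrass_m_test[OF _ sw]) auto
  have "continuous_on {0..L} (u 0)"
    by (rule uniform_limit_theorem[OF always_eventually[OF allI[OF cont]] ul]) simp
  then have uL2: "u \<in> L2 ?C"
    unfolding L2_loop_graph by (rule square_integrable_on_continuous)
  have "(\<lambda>N. LBINT x:{0..L}. ((\<Sum>n<N. c n * ?\<phi> n 0 x) - u 0 x)\<^sup>2) \<longlonglongrightarrow> 0"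
  proof (rule square_integrable_dominated_convergence[where w = "\<lambda>x. suminf w"])
    show "square_integrable_on {0..L} (\<lambda>x. \<Sum>n<N. c n * ?\<phi> n 0 x)" for N
      by (intro square_integrable_on_continuous cont)
    show "square_integrable_on {0..L} (u 0)" using uL2 by (simp add: L2_loop_graph)
    show "square_integrable_on {0..L} (\<lambda>x. suminf w)"
      by (intro square_integrable_on_continuous continuous_intros)
    show "AE x in lborel. x \<in> {0..L} \<longrightarrow> (\<lambda>N. \<Sum>n<N. c n * ?\<phi> n 0 x) \<longlonglongrightarrow> u 0 x"
      unfolding u_def using summable_LIMSEQ[OF sc] by simp
    show "\<bar>(\<Sum>n<N. c n * ?\<phi> n 0 x) - u 0 x\<bar> \<le> \<bar>suminf w\<bar>" for N x
    proof -
      have "u 0 x - (\<Sum>n<N. c n * ?\<phi> n 0 x) = (\<Sum>n. c (n + N) * ?\<phi> (n + N) 0 x)"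
        unfolding u_def using suminf_split_initial_segment[OF sc[of 0 x], of N] by simp
      also have "\<bar>\<dots>\<bar> \<le> (\<Sum>n. w (n + N))"
      proof -
        have "summable (\<lambda>n. w (n + N))" using sw by (simp add: summable_iff_shift)
        then show ?thesis
          using bound norm_suminf_le[of "\<lambda>n. c (n + N) * ?\<phi> (n + N) 0 x" "\<lambda>n. w (n + N)"] by simp
      qed
      also have "\<dots> = suminf w - sum w {..<N}"
        using suminf_split_initial_segment[OF sw, of N] by simp
      also have "\<dots> \<le> \<bar>suminf w\<bar>"
      proof -
        have "0 \<le> sum w {..<N}"
          by (intro sum_nonneg order_trans[OF abs_ge_zero bound])
        then show ?thesis by linarith
      qed
      finally show ?thesis by (simp add: abs_minus_commute)
    qed
  qed
  then have "L2_sums ?C (\<lambda>n e x. c n * ?\<phi> n e x) u"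
    unfolding L2_sums_def L2_norm_def L2_inner_loop_graph
    using tendsto_real_sqrt by (force simp: power2_eq_square[symmetric] power2_commute)
  then have *: "(\<lambda>n. L2_inner ?C (\<lambda>e x. c n * ?\<phi> n e x) (?\<phi> k)) sums L2_inner ?C u (?\<phi> k)" for k
    by (rule L2_sums_inner) (intro L2_scale \<phi> uL2)+
  have uc: "L2_inner ?C u (?\<phi> k) = c k" for k
  proof -
    have "(\<lambda>n. L2_inner ?C (\<lambda>e x. c n * ?\<phi> n e x) (?\<phi> k)) = (\<lambda>n. if n = k then c k else 0)"
      by (auto simp: L2_inner_scale_left sine_eigenfunction_orthonormal[OF L])
    then show ?thesis
      using *[of k] sums_single[of k "\<lambda>_. c k"] by (simp add: sums_unique2)
  qed
  have bc: "?lam n powr \<alpha> * c n = b n" for n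
    using lampos[of n] by (simp add: c_def powr_minus)
  have "(\<lambda>n. b n * b n) sums L2_inner ?C (\<lambda>e x. 1) (\<lambda>e x. 1)"
    unfolding b_def by (rule orthonormal_basis_parseval[OF ob L2_const L2_const])
  then have "summable (\<lambda>n. b n * b n)" by (rule sums_summable)
  also have "(\<lambda>n. b n * b n) = (\<lambda>n. ?lam n powr (2 * \<alpha>) * \<bar>c n\<bar>\<^sup>2)"
  proof
    fix n
    have "?lam n powr (2 * \<alpha>) = (?lam n powr \<alpha>)\<^sup>2"
      using lampos[of n] by (simp add: power2_eq_square flip: powr_add)
    then show "b n * b n = ?lam n powr (2 * \<alpha>) * \<bar>c n\<bar>\<^sup>2"
      using bc[of n] by (simp add: power_mult_distrib[symmetric] flip: power2_eq_square)
  qed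
  finally have 1: "summable (\<lambda>n. ?lam n powr (2 * \<alpha>) * \<bar>c n\<bar>\<^sup>2)" .
  \<comment> \<open>By \<open>bc\<close> this is the sine expansion of 1 itself.\<close>
  have 2: "L2_sums ?C (\<lambda>n e x. ?lam n powr \<alpha> * c n * ?\<phi> n e x) (\<lambda>e x. 1)"
    using ob L2_const[of 1] unfolding bc b_def orthonormal_basis_def by blast
  show ?thesis
    unfolding frac_laplacian_def
    by (intro exI[of _ u] exI[of _ ?lam] exI[of _ ?\<phi>] conjI eigenbasis_sine[OF L] uL2 L2_const)
      (simp_all only: uc 1 2)
qed

section \<open>Euler circuits\<close>

text \<open>
  A walk traverses arcs in either direction: \<open>(e, True)\<close> from tail to head, \<open>(e, False)\<close> from head
  to tail.
\<close>

fun walk :: "('v, 'e) pre_digraph \<Rightarrow> 'v \<Rightarrow> ('e \<times> bool) list \<Rightarrow> 'v \<Rightarrow> bool" where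
  "walk D u [] v \<longleftrightarrow> u = v"
| "walk D u ((e, b) # p) v \<longleftrightarrow> e \<in> arcs D \<and> u = (if b then tail D e else head D e) \<and>
     walk D (if b then head D e else tail D e) p v"

lemma walk_append: "walk D u (p @ q) w \<longleftrightarrow> (\<exists>v. walk D u p v \<and> walk D v q w)"
proof (induction p arbitrary: u)
  case (Cons a p)
  then show ?case by (cases a) (simp only: walk.simps append_Cons, blast)
qed simp

lemma walk_arcs: "walk D u p v \<Longrightarrow> fst ` set p \<subseteq> arcs D"
  by (induction D u p v rule: walk.induct) auto

lemma walk_end_in_verts:
  assumes "fin_digraph D" "walk D u p v" "u \<in> verts D"
  shows "v \<in> verts D"
proof -
  interpret fin_digraph D by fact
  show ?thesis using assms(2,3)
  proof (induction p arbitrary: u)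
    case (Cons a p)
    then show ?case by (cases a) (auto split: if_splits)
  qed simp
qed

text \<open>Counting ends arc by arc lets a degree be split into the contributions of the arcs on a
  trail and off it; a loop counts twice.\<close>

definition end_count :: "('v, 'e) pre_digraph \<Rightarrow> 'v \<Rightarrow> 'e \<Rightarrow> nat" where
  "end_count D w e = of_bool (tail D e = w) + of_bool (head D e = w)"

lemma degree_eq_sum_end_count:
  assumes "finite (arcs D)"
  shows "in_degree D w + out_degree D w = (\<Sum>e\<in>arcs D. end_count D w e)"
proof -
  have "(\<Sum>e\<in>arcs D. of_bool (P e)) = card {e \<in> arcs D. P e}" for P
    using assms by (simp add: of_bool_def sum.If_cases Int_def)
  then show ?thesis
    by (simp add: end_count_def sum.distrib in_degree_def out_degree_def in_arcs_def out_arcs_def)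
qed

text \<open>Each passage through \<open>w\<close> uses one end on arrival and one on departure. The
  two correction terms pair up the ends left over at the start and at the finish.\<close>

lemma walk_parity:
  "walk D u p v \<Longrightarrow> even ((\<Sum>x\<leftarrow>p. end_count D w (fst x)) + of_bool (u = w) + of_bool (v = w))"
  by (induction D u p v rule: walk.induct) (auto simp: end_count_def split: if_splits)

lemma trail_parity:
  assumes "walk D u p v" "distinct (map fst p)"
  shows "even ((\<Sum>e\<in>fst ` set p. end_count D w e) + of_bool (u = w) + of_bool (v = w))"
  using walk_parity[OF assms(1), of w] sum_list_distinct_conv_sum_set[OF assms(2), of "end_count D w"]
  by (simp add: o_def)

text \<open>
  A trail of maximal length is closed by parity. As it can be rotated to start at any vertex it visits,
  an unused arc at such a vertex would extend it; by connectedness no arc is unused.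
\<close>

lemma euler_circuit:
  assumes D: "fin_digraph D"
    and even: "\<And>v. v \<in> verts D \<Longrightarrow> even (in_degree D v + out_degree D v)"
    and conn: "\<And>S. S \<subseteq> verts D \<Longrightarrow> S \<noteq> {} \<Longrightarrow>
      (\<And>e. e \<in> arcs D \<Longrightarrow> tail D e \<in> S \<longleftrightarrow> head D e \<in> S) \<Longrightarrow> S = verts D"
    and d: "d \<in> verts D"
  obtains p where "walk D d p d" "distinct (map fst p)" "fst ` set p = arcs D"
proof -
  interpret fin_digraph D by fact
  define P where "P = (\<lambda>(u, p, v). u \<in> verts D \<and> walk D u p v \<and> distinct (map fst p))"
  have bound: "length p \<le> card (arcs D)" if "P (u, p, v)" for u p v
  proof -
    have "length p = card (fst ` set p)"
      using that distinct_card[of "map fst p"] by (simp add: P_def)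
    also have "\<dots> \<le> card (arcs D)"
      using that walk_arcs[of D u p v] by (intro card_mono) (auto simp: P_def)
    finally show ?thesis .
  qed
  have "\<exists>x. P x \<and> (\<forall>y. P y \<longrightarrow> length (fst (snd y)) \<le> length (fst (snd x)))"
  proof (rule ex_has_greatest_nat)
    show "P (d, [], d)" using d by (simp add: P_def)
    show "\<forall>y. P y \<longrightarrow> length (fst (snd y)) < Suc (card (arcs D))" using bound by (auto simp: less_Suc_eq_le)
  qed
  then obtain u p v where Pp: "P (u, p, v)" and max: "\<And>u' q v'. P (u', q, v') \<Longrightarrow> length q \<le> length p"
    by (metis fst_conv snd_conv prod_cases3)
  have u: "u \<in> verts D" and p: "walk D u p v" "distinct (map fst p)" using Pp by (auto simp: P_def)
  \<comment> \<open>Every trail as long as \<open>p\<close> is maximal as well. Stating this for all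
    of them makes it applicable to the rotations of \<open>p\<close>.\<close>
  have no_ext: False if "e \<in> arcs D" "e \<notin> fst ` set q" "tail D e = w \<or> head D e = w"
    and q: "P (u', q, w)" "length q = length p" for e q u' w
  proof -
    define b where "b = (tail D e = w)"
    have "P (u', q @ [(e, b)], if b then head D e else tail D e)"
      using that by (auto simp: P_def walk_append b_def)
    from max[OF this] q(2) show False by simp
  qed
  have sub: "fst ` set p \<subseteq> arcs D" using walk_arcs[OF p(1)] .
  have "u = v"
  proof (rule ccontr)
    assume "u \<noteq> v"
    then have "odd (\<Sum>e\<in>fst ` set p. end_count D v e)"
      using trail_parity[OF p, of v] by simp
    moreover have "even (\<Sum>e\<in>arcs D. end_count D v e)"
      using even[OF walk_end_in_verts[OF D p(1) u]] degree_eq_sum_end_count[of D v] by simp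
    ultimately have "(\<Sum>e\<in>arcs D. end_count D v e) \<noteq> (\<Sum>e\<in>fst ` set p. end_count D v e)" by auto
    then have "(\<Sum>e\<in>arcs D - fst ` set p. end_count D v e) \<noteq> 0"
      using sum.subset_diff[OF sub finite_arcs, of "end_count D v"] by simp
    then obtain e where "e \<in> arcs D" "e \<notin> fst ` set p" "end_count D v e \<noteq> 0"
      by (meson DiffE sum.not_neutral_contains_not_neutral)
    then show False using no_ext[of e p v u] Pp by (auto simp: end_count_def split: if_splits)
  qed
  \<comment> \<open>The vertices at which \<open>p\<close> can be split, hence at which a rotation
    of it can start.\<close>
  define S where "S = {w. \<exists>q r. p = q @ r \<and> walk D u q w \<and> walk D w r u}"
  have rotate: "P (w, r @ q, w)" "length (r @ q) = length p" "fst ` set (r @ q) = fst ` set p"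
    if "p = q @ r" "walk D u q w" "walk D w r u" for q r w
    using that p(2) walk_end_in_verts[OF D that(2) u]
    by (auto simp: P_def walk_append)
  have used: "tail D e \<in> S \<and> head D e \<in> S" if "e \<in> fst ` set p" for e
  proof -
    obtain b where "(e, b) \<in> set p" using \<open>e \<in> fst ` set p\<close> by auto
    then obtain q r where qr: "p = q @ (e, b) # r" by (meson split_list)
    let ?s = "if b then tail D e else head D e" and ?t = "if b then head D e else tail D e"
    have w: "walk D u q ?s" "walk D ?t r u" "e \<in> arcs D"
      using p(1) qr \<open>u = v\<close> by (auto simp: walk_append)
    have "?s \<in> S" unfolding S_def
      using w qr by (intro CollectI exI[of _ q] exI[of _ "(e, b) # r"]) auto
    moreover have "?t \<in> S" unfolding S_def
      using w qr by (intro CollectI exI[of _ "q @ [(e, b)]"] exI[of _ r]) (auto simp: walk_append)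
    ultimately show ?thesis by (auto split: if_splits)
  qed
  have unused: "tail D e \<notin> S \<and> head D e \<notin> S" if "e \<in> arcs D" "e \<notin> fst ` set p" for e
  proof (rule ccontr)
    assume "\<not> (tail D e \<notin> S \<and> head D e \<notin> S)"
    then obtain w where w: "tail D e = w \<or> head D e = w" "w \<in> S" by auto
    then obtain q r where qr: "p = q @ r" "walk D u q w" "walk D w r u" by (auto simp: S_def)
    show False
      using no_ext[of e "r @ q" w w] that w(1) rotate[OF qr] by auto
  qed
  have "S = verts D"
  proof (rule conn)
    show "S \<subseteq> verts D" using walk_end_in_verts[OF D _ u] by (auto simp: S_def)
    have "u \<in> S" unfolding S_def using p(1) \<open>u = v\<close> by (intro CollectI exI[of _ "[]"] exI[of _ p]) auto
    then show "S \<noteq> {}" by auto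
    show "tail D e \<in> S \<longleftrightarrow> head D e \<in> S" if "e \<in> arcs D" for e
      using used unused that by blast
  qed
  then have all: "fst ` set p = arcs D" using sub unused tail_in_verts by blast
  have "d \<in> S" using d \<open>S = verts D\<close> by simp
  then obtain q r where qr: "p = q @ r" "walk D u q d" "walk D d r u" by (auto simp: S_def)
  show ?thesis
    using that[of "r @ q"] rotate[OF qr] all by (auto simp: P_def)
qed

text \<open>For a vertex set closed under adjacency, add the open edges that start in it: the
  preimage in each edge interval is everything or nothing, so the set is open. Applied to
  \<open>S\<close> and to its complement, this would disconnect the space.\<close>

lemma (in metric_graph) connected_space_imp_connected:
  assumes conn: "connected_space (graph_space G)"
    and S: "S \<subseteq> vertices G" "S \<noteq> {}"
    and closed: "\<And>e. e \<in> edges G \<Longrightarrow> tail (skel G) e \<in> S \<longleftrightarrow> head (skel G) e \<in> S"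
  shows "S = vertices G"
proof (rule ccontr)
  assume "S \<noteq> vertices G"
  interpret fin_digraph "skel G" by (rule fin_digraph_skel)
  define U where "U T = Inl ` T \<union> Inr ` (SIGMA e:{e \<in> edges G. tail (skel G) e \<in> T}. {0<..<len G e})" for T
  have op: "openin (graph_space G) (U T)"
    if T: "T \<subseteq> vertices G" and cl: "\<And>e. e \<in> edges G \<Longrightarrow> tail (skel G) e \<in> T \<longleftrightarrow> head (skel G) e \<in> T" for T
    unfolding openin_graph_space
  proof (intro conjI ballI)
    show "U T \<subseteq> points G" using T by (auto simp: U_def points_def)
    fix e assume e: "e \<in> edges G"
    have "{x \<in> {0..len G e}. point G e x \<in> U T} = (if tail (skel G) e \<in> T then {0..len G e} else {})"
      using e cl[OF e] by (auto simp: U_def point_def)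
    then show "openin (top_of_set {0..len G e}) {x \<in> {0..len G e}. point G e x \<in> U T}" by simp
  qed
  have "openin (graph_space G) (U S)" using S closed by (intro op)
  moreover have "openin (graph_space G) (U (vertices G - S))"
    using closed by (intro op) auto
  moreover have "topspace (graph_space G) \<subseteq> U S \<union> U (vertices G - S)"
  proof -
    have "topspace (graph_space G) \<subseteq> points G"
      using openin_topspace[of "graph_space G"] by (simp only: openin_graph_space)
    also have "\<dots> \<subseteq> U S \<union> U (vertices G - S)" by (auto simp: points_def U_def)
    finally show ?thesis .
  qed
  moreover have "U S \<inter> U (vertices G - S) = {}" by (auto simp: U_def)
  moreover have "U S \<noteq> {}" "U (vertices G - S) \<noteq> {}"
    using S \<open>S \<noteq> vertices G\<close> by (auto simp: U_def)
  ultimately show False using conn unfolding connected_space_def by blast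
qed

section \<open>Cutting open along a circuit\<close>

text \<open>
  Laying the arcs of a walk \<open>p\<close> one after the other on the line, starting at \<open>c\<close>, puts the point \<open>x\<close>
  of the arc \<open>e\<close> at \<open>walk_pos l c p e x\<close>; \<open>walk_sign p e\<close> is the slope of this map. Both are
  meaningful only if \<open>e\<close> occurs exactly once in \<open>p\<close>.
\<close>

fun walk_pos :: "('e \<Rightarrow> real) \<Rightarrow> real \<Rightarrow> ('e \<times> bool) list \<Rightarrow> 'e \<Rightarrow> real \<Rightarrow> real" where
  "walk_pos l c [] e x = 0"
| "walk_pos l c ((e', b) # p) e x =
     (if e = e' then if b then c + x else c + l e' - x else walk_pos l (c + l e') p e x)"

fun walk_sign :: "('e \<times> bool) list \<Rightarrow> 'e \<Rightarrow> real" where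
  "walk_sign [] e = 1"
| "walk_sign ((e', b) # p) e = (if e = e' then if b then 1 else - 1 else walk_sign p e)"

abbreviation walk_length :: "('e \<Rightarrow> real) \<Rightarrow> ('e \<times> bool) list \<Rightarrow> real" where
  "walk_length l p \<equiv> (\<Sum>y\<leftarrow>p. l (fst y))"

text \<open>The default value 1 of \<open>walk_sign\<close> off the walk is what makes this an
  unconditional rewrite rule.\<close>

lemma walk_sign_square: "walk_sign p e * walk_sign p e = 1"
  by (induction p e rule: walk_sign.induct) auto

lemma walk_pos_derivative:
  "e \<in> fst ` set p \<Longrightarrow> (walk_pos l c p e has_real_derivative walk_sign p e) (at x within A)"
proof (induction p arbitrary: c)
  case (Cons y p)
  obtain e' b where y: "y = (e', b)" by (cases y)
  consider "e = e'" b | "e = e'" "\<not> b" | "e \<noteq> e'" by blast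
  then show ?case
  proof cases
    case 1
    then have "walk_pos l c (y # p) e = (\<lambda>x. c + x)" "walk_sign (y # p) e = 1" by (auto simp: y)
    then show ?thesis by (auto intro!: derivative_eq_intros)
  next
    case 2
    then have "walk_pos l c (y # p) e = (\<lambda>x. c + l e' - x)" "walk_sign (y # p) e = - 1" by (auto simp: y)
    then show ?thesis by (auto intro!: derivative_eq_intros)
  next
    case 3
    then have "walk_pos l c (y # p) e = walk_pos l (c + l e') p e" "walk_sign (y # p) e = walk_sign p e"
      by (auto simp: y)
    then show ?thesis using 3 Cons by (auto simp: y)
  qed
qed simp

lemma walk_length_nonneg:
  assumes "\<And>e. e \<in> fst ` set p \<Longrightarrow> 0 \<le> l e"
  shows "0 \<le> walk_length l p"
  using assms by (intro sum_list_nonneg) auto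

lemma walk_pos_range:
  assumes "e \<in> fst ` set p" "\<And>e. e \<in> fst ` set p \<Longrightarrow> 0 \<le> l e" "x \<in> {0..l e}"
  shows "walk_pos l c p e x \<in> {c..c + walk_length l p}"
  using assms
proof (induction p arbitrary: c)
  case (Cons y p)
  obtain e' b where y: "y = (e', b)" by (cases y)
  have nn: "0 \<le> walk_length l p" using Cons.prems(2) by (intro walk_length_nonneg) auto
  have "0 \<le> l e'" using Cons.prems(2)[of e'] by (auto simp: y)
  show ?case
  proof (cases "e = e'")
    case True
    then show ?thesis using Cons.prems(3) nn by (auto simp: y)
  next
    case False
    then have "walk_pos l (c + l e') p e x \<in> {c + l e'..c + l e' + walk_length l p}"
      using Cons.prems by (intro Cons.IH) (auto simp: y)
    then show ?thesis using False \<open>0 \<le> l e'\<close> by (auto simp: y add.assoc)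
  qed
qed simp

text \<open>Consecutive arcs share a vertex, where \<open>val\<close> agrees, and a position, where
  \<open>H\<close> agrees, so inner boundary terms cancel; the sign corrects for arcs traversed
  backwards. With \<open>val\<close> constant this yields the change of variables, with the vertex
  values of a function the integration by parts.\<close>

lemma walk_telescope:
  fixes val :: "'v \<Rightarrow> real" and H :: "real \<Rightarrow> real"
  assumes "walk D u p v" "distinct (map fst p)"
  shows "(\<Sum>e\<in>fst ` set p. walk_sign p e *
      (val (head D e) * H (walk_pos l c p e (l e)) - val (tail D e) * H (walk_pos l c p e 0)))
    = val v * H (c + walk_length l p) - val u * H c"
  using assms
proof (induction p arbitrary: c u)
  case (Cons y p)
  obtain e' b where y: "y = (e', b)" by (cases y)
  have new: "e' \<notin> fst ` set p" using Cons.prems(2) by (auto simp: y)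
  let ?T = "\<lambda>p c e. walk_sign p e *
      (val (head D e) * H (walk_pos l c p e (l e)) - val (tail D e) * H (walk_pos l c p e 0))"
  let ?w = "if b then head D e' else tail D e'"
  have "(\<Sum>e\<in>fst ` set (y # p). ?T (y # p) c e) = ?T (y # p) c e' + (\<Sum>e\<in>fst ` set p. ?T (y # p) c e)"
    using new by (simp add: y)
  also have "(\<Sum>e\<in>fst ` set p. ?T (y # p) c e) = (\<Sum>e\<in>fst ` set p. ?T p (c + l e') e)"
    using new by (intro sum.cong) (auto simp: y)
  also have "\<dots> = val v * H (c + l e' + walk_length l p) - val ?w * H (c + l e')"
    using Cons.prems by (intro Cons.IH) (auto simp: y)
  also have "?T (y # p) c e' = val ?w * H (c + l e') - val u * H c"
    using Cons.prems(1) by (auto simp: y split: if_splits)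
  finally show ?case by (simp add: y add.assoc)
qed simp

section \<open>Eigenfunctions as classical solutions, and Green's identity\<close>

lemma integration_by_parts_Icc:
  fixes f f' g g' g'' :: "real \<Rightarrow> real"
  assumes "0 \<le> l"
    and f: "\<And>x. x \<in> {0..l} \<Longrightarrow> (f has_real_derivative f' x) (at x within {0..l})"
    and g: "\<And>x. x \<in> {0..l} \<Longrightarrow> (g' has_real_derivative g'' x) (at x within {0..l})"
    and cont: "continuous_on {0..l} f'" "continuous_on {0..l} g''"
  shows "(LBINT x:{0..l}. f' x * g' x) = f l * g' l - f 0 * g' 0 - (LBINT x:{0..l}. f x * g'' x)"
proof -
  have c: "continuous_on {0..l} f" "continuous_on {0..l} g'"
    by (rule DERIV_continuous_on, erule f, rule DERIV_continuous_on, erule g)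
  have "(LBINT x:{0..l}. f' x * g' x + f x * g'' x) = f l * g' l - f 0 * g' 0"
  proof (rule LBINT_FTC[OF assms(1), where F = "\<lambda>x. f x * g' x"])
    show "((\<lambda>x. f x * g' x) has_real_derivative f' x * g' x + f x * g'' x) (at x within {0..l})"
      if "x \<in> {0..l}" for x
      using DERIV_mult[OF f[OF that] g[OF that]] by (simp add: mult.commute)
    show "continuous_on {0..l} (\<lambda>x. f' x * g' x + f x * g'' x)"
      by (intro continuous_intros c cont)
  qed
  moreover have "(LBINT x:{0..l}. f' x * g' x + f x * g'' x)
      = (LBINT x:{0..l}. f' x * g' x) + (LBINT x:{0..l}. f x * g'' x)"
    by (intro set_integral_add borel_integrable_atLeastAtMost' continuous_intros c cont)
  ultimately show ?thesis by simp
qed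

context metric_graph
begin

text \<open>Replaces the weak second derivative of \<open>H2_on\<close> by a pointwise equation up
  to the endpoints, which puts integration by parts within reach of the classical fundamental
  theorem.\<close>

definition eigenpair :: "'e graph_fun \<Rightarrow> 'e graph_fun \<Rightarrow> real \<Rightarrow> bool" where
  "eigenpair f f' m \<longleftrightarrow> vertex_conditions G f f' \<and>
     (\<forall>e\<in>edges G. \<forall>x\<in>{0..len G e}.
        (f e has_real_derivative f' e x) (at x within {0..len G e}) \<and>
        (f' e has_real_derivative - (m * f e x)) (at x within {0..len G e}))"

lemma eigenpairD:
  assumes "eigenpair f f' m" "e \<in> edges G"
  shows "x \<in> {0..len G e} \<Longrightarrow> (f e has_real_derivative f' e x) (at x within {0..len G e})"
    and "x \<in> {0..len G e} \<Longrightarrow> (f' e has_real_derivative - (m * f e x)) (at x within {0..len G e})"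
    and "continuous_on {0..len G e} (f e)" and "continuous_on {0..len G e} (f' e)"
proof -
  show f: "x \<in> {0..len G e} \<Longrightarrow> (f e has_real_derivative f' e x) (at x within {0..len G e})"
    and f': "x \<in> {0..len G e} \<Longrightarrow> (f' e has_real_derivative - (m * f e x)) (at x within {0..len G e})" for x
    using assms unfolding eigenpair_def by blast+
  show "continuous_on {0..len G e} (f e)" "continuous_on {0..len G e} (f' e)"
    by (rule DERIV_continuous_on, erule f, rule DERIV_continuous_on, erule f')
qed

text \<open>Bootstrapping: an eigenfunction is continuous, hence so is its second derivative, which
  is a multiple of it, and the integral formula for \<open>f'\<close> can be differentiated at every
  point.\<close>

lemma eigenpair_exists:
  assumes "neg_laplacian G f (\<lambda>e x. m * f e x)"
  shows "\<exists>f'. eigenpair f f' m"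
proof -
  obtain f' where H: "\<And>e. e \<in> edges G \<Longrightarrow> H2_on (len G e) (f e) (f' e) (\<lambda>x. - (m * f e x))"
    and vc: "vertex_conditions G f f'"
    using assms unfolding neg_laplacian_def by blast
  have "(f' e has_real_derivative - (m * f e x)) (at x within {0..len G e})"
    if e: "e \<in> edges G" and x: "x \<in> {0..len G e}" for e x
  proof -
    let ?g = "\<lambda>x. - (m * f e x)"
    have "continuous_on {0..len G e} (f e)"
      using H[OF e] unfolding H2_on_def by (blast intro: DERIV_continuous_on)
    then have c: "continuous_on {0..len G e} ?g" by (intro continuous_intros)
    have "((\<lambda>u. integral {0..u} ?g) has_real_derivative ?g x) (at x within {0..len G e})"
      unfolding has_real_derivative_iff_has_vector_derivative
      by (rule integral_has_vector_derivative[OF c x])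
    from DERIV_add[OF DERIV_const[of "f' e 0"] this]
    have "((\<lambda>u. f' e 0 + integral {0..u} ?g) has_real_derivative ?g x) (at x within {0..len G e})"
      by (simp only: add_0_left)
    moreover have "f' e 0 + integral {0..u} ?g = f' e u" if u: "u \<in> {0..len G e}" for u
    proof -
      have "set_integrable lborel {0..u} ?g"
        using u by (intro borel_integrable_atLeastAtMost' continuous_on_subset[OF c]) auto
      then have "(LBINT y:{0..u}. ?g y) = integral {0..u} ?g"
        by (rule set_borel_integral_eq_integral(2))
      moreover have "f' e u = f' e 0 + (LBINT y:{0..u}. ?g y)"
        using H[OF e] u unfolding H2_on_def by blast
      ultimately show ?thesis by (simp only:)
    qed
    ultimately show ?thesis
      by (rule has_field_derivative_transform_within[OF _ zero_less_one x])
  qed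
  then show ?thesis using H vc unfolding eigenpair_def H2_on_def by blast
qed

text \<open>Regrouping the arc ends by vertex factors out \<open>val v\<close>. What remains is the
  Kirchhoff sum, which vanishes off the Dirichlet set; on that set \<open>val v\<close>
  vanishes.\<close>

lemma vertex_conditions_boundary_sum:
  assumes vc: "vertex_conditions G g g'" and val: "\<And>v. v \<in> dirichlet G \<Longrightarrow> val v = 0"
  shows "(\<Sum>e\<in>edges G. val (head (skel G) e) * g' e (len G e) - val (tail (skel G) e) * g' e 0) = (0::real)"
proof -
  interpret fin_digraph "skel G" by (rule fin_digraph_skel)
  have h: "(\<Sum>e\<in>edges G. val (head (skel G) e) * g' e (len G e))
      = (\<Sum>v\<in>vertices G. val v * (\<Sum>e\<in>in_arcs (skel G) v. g' e (len G e)))"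
    unfolding sum_distrib_left in_arcs_def
    by (subst sum.group[of "edges G" "vertices G" "head (skel G)", symmetric]) auto
  have t: "(\<Sum>e\<in>edges G. val (tail (skel G) e) * - g' e 0)
      = (\<Sum>v\<in>vertices G. val v * (\<Sum>e\<in>out_arcs (skel G) v. - g' e 0))"
    unfolding sum_distrib_left out_arcs_def
    by (subst sum.group[of "edges G" "vertices G" "tail (skel G)", symmetric]) auto
  have "(\<Sum>e\<in>edges G. val (head (skel G) e) * g' e (len G e) - val (tail (skel G) e) * g' e 0)
      = (\<Sum>e\<in>edges G. val (head (skel G) e) * g' e (len G e)) + (\<Sum>e\<in>edges G. val (tail (skel G) e) * - g' e 0)"
    by (simp add: sum_subtractf sum_negf)
  also have "\<dots> = (\<Sum>v\<in>vertices G. val v * ((\<Sum>e\<in>in_arcs (skel G) v. g' e (len G e)) + (\<Sum>e\<in>out_arcs (skel G) v. - g' e 0)))"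
    unfolding h t by (simp only: sum.distrib distrib_left)
  also have "\<dots> = 0"
    using vc val unfolding vertex_conditions_def by (intro sum.neutral) (metis DiffI mult_eq_0_iff)
  finally show ?thesis .
qed

text \<open>The weak form of the eigenvalue equation for \<open>g\<close>, tested with
  \<open>f\<close>. Within an eigenbasis it makes the derivatives orthogonal, with the eigenvalues
  as squared norms.\<close>

lemma green_identity:
  assumes f: "eigenpair f f' m" and g: "eigenpair g g' m'"
  shows "L2_inner G f' g' = m' * L2_inner G f g"
proof -
  obtain val where val: "\<And>e. e \<in> edges G \<Longrightarrow> f e 0 = val (tail (skel G) e) \<and> f e (len G e) = val (head (skel G) e)"
      "\<And>v. v \<in> dirichlet G \<Longrightarrow> val v = 0"
    using f unfolding eigenpair_def vertex_conditions_def by blast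
  have "L2_inner G f' g' = (\<Sum>e\<in>edges G. f e (len G e) * g' e (len G e) - f e 0 * g' e 0
      - (LBINT x:{0..len G e}. f e x * - (m' * g e x)))"
    unfolding L2_inner_def graph_integral_def
  proof (rule sum.cong[OF refl])
    fix e assume e: "e \<in> edges G"
    show "(LBINT x:{0..len G e}. f' e x * g' e x) = f e (len G e) * g' e (len G e) - f e 0 * g' e 0
        - (LBINT x:{0..len G e}. f e x * - (m' * g e x))"
      using len_pos[OF e]
      by (intro integration_by_parts_Icc eigenpairD[OF f e] eigenpairD[OF g e] continuous_intros) auto
  qed
  also have "\<dots> = (\<Sum>e\<in>edges G. val (head (skel G) e) * g' e (len G e) - val (tail (skel G) e) * g' e 0)
      + (\<Sum>e\<in>edges G. m' * (LBINT x:{0..len G e}. f e x * g e x))"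
    unfolding sum.distrib[symmetric]
  proof (intro sum.cong refl)
    fix e assume e: "e \<in> edges G"
    have "(\<lambda>x. f e x * - (m' * g e x)) = (\<lambda>x. - m' * (f e x * g e x))" by auto
    then have "(LBINT x:{0..len G e}. f e x * - (m' * g e x)) = - m' * (LBINT x:{0..len G e}. f e x * g e x)"
      by (simp only: set_integral_mult_right)
    then show "f e (len G e) * g' e (len G e) - f e 0 * g' e 0 - (LBINT x:{0..len G e}. f e x * - (m' * g e x))
        = val (head (skel G) e) * g' e (len G e) - val (tail (skel G) e) * g' e 0
          + m' * (LBINT x:{0..len G e}. f e x * g e x)"
      using val(1)[OF e] by simp
  qed
  also have "\<dots> = m' * L2_inner G f g"
    using vertex_conditions_boundary_sum[OF _ val(2), of g g'] g
    by (simp add: eigenpair_def L2_inner_def graph_integral_def sum_distrib_left)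
  finally show ?thesis .
qed

end

text \<open>
  Cutting \<open>G\<close> open along an Euler circuit through a Dirichlet vertex. Functions on \<open>[0, L]\<close> are
  pulled back to \<open>G\<close>, so that both eigenbases live on the same graph.
\<close>

locale euler_graph = metric_graph G for G :: "('v, 'e) metric_graph" +
  fixes p :: "('e \<times> bool) list" and d :: 'v
  assumes circuit: "walk (skel G) d p d"
    and trail: "distinct (map fst p)"
    and covers: "fst ` set p = edges G"
    and dirichlet: "d \<in> dirichlet G"
begin

section \<open>Pulling functions on \<open>[0, L]\<close> back along the circuit\<close>

abbreviation L :: real where "L \<equiv> total_length G"

abbreviation C :: "(nat, nat) metric_graph" where "C \<equiv> loop_graph L"

abbreviation pos :: "'e \<Rightarrow> real \<Rightarrow> real" where "pos \<equiv> walk_pos (len G) 0 p"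

lemma walk_length_circuit: "walk_length (len G) p = L"
  using sum_list_distinct_conv_sum_set[OF trail, of "len G"] covers
  by (simp add: total_length_def o_def)

lemma L_pos: "0 < L"
  unfolding total_length_def using finite_edges edges_nonempty len_pos by (rule sum_pos)

sublocale loop: metric_graph C
  by (rule metric_graph_loop_graph[OF L_pos])

lemma pos_range:
  assumes "e \<in> edges G" "x \<in> {0..len G e}"
  shows "pos e x \<in> {0..L}"
  using walk_pos_range[of e p "len G" x 0] assms covers len_pos less_imp_le
  by (auto simp: walk_length_circuit)

lemma pos_continuous: "e \<in> edges G \<Longrightarrow> continuous_on A (pos e)"
  by (rule DERIV_continuous_on, rule walk_pos_derivative) (simp add: covers)

lemma pull_continuous:
  "continuous_on {0..L} h \<Longrightarrow> e \<in> edges G \<Longrightarrow> continuous_on {0..len G e} (\<lambda>x. h (pos e x))"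
  by (rule continuous_on_compose2[OF _ pos_continuous]) (auto dest: pos_range)

lemma pull_derivative:
  assumes H: "\<And>y. y \<in> {0..L} \<Longrightarrow> (H has_real_derivative h y) (at y within {0..L})"
    and e: "e \<in> edges G" and x: "x \<in> {0..len G e}"
  shows "((\<lambda>x. H (pos e x)) has_real_derivative walk_sign p e * h (pos e x)) (at x within {0..len G e})"
proof -
  have "(H has_real_derivative h (pos e x)) (at (pos e x) within pos e ` {0..len G e})"
    using H[OF pos_range[OF e x]] by (rule has_field_derivative_subset) (use pos_range[OF e] in auto)
  from DERIV_image_chain[OF this walk_pos_derivative] show ?thesis
    using e covers by (simp add: o_def mult.commute)
qed

text \<open>The only surviving boundary terms sit at \<open>d\<close>, where the circuit starts and
  ends. For Green's identity they vanish because \<open>d\<close> is Dirichlet.\<close>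

lemma telescope:
  assumes "val d = 0 \<or> H 0 = H L"
  shows "(\<Sum>e\<in>edges G. walk_sign p e *
    (val (head (skel G) e) * H (pos e (len G e)) - val (tail (skel G) e) * H (pos e 0))) = (0::real)"
  using walk_telescope[OF circuit trail, of val H "len G" 0] assms
  by (auto simp: covers walk_length_circuit)

text \<open>An antiderivative of \<open>h\<close>, pulled back and multiplied by the sign, is an
  antiderivative on each arc because the sign squares to 1; the boundary terms telescope along the
  circuit.\<close>

lemma pull_integral:
  assumes h: "continuous_on {0..L} h"
  shows "graph_integral G (\<lambda>e x. h (pos e x)) = (LBINT x:{0..L}. h x)"
proof -
  obtain H where H: "\<And>x. x \<in> {0..L} \<Longrightarrow> (H has_real_derivative h x) (at x within {0..L})"
    using antiderivative_continuous[OF h] unfolding has_real_derivative_iff_has_vector_derivative by blast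
  have "graph_integral G (\<lambda>e x. h (pos e x))
      = (\<Sum>e\<in>edges G. walk_sign p e * H (pos e (len G e)) - walk_sign p e * H (pos e 0))"
    unfolding graph_integral_def
  proof (intro sum.cong refl LBINT_FTC[where F = "\<lambda>x. walk_sign p e * H (pos e x)" for e])
    fix e x assume e: "e \<in> edges G" and x: "x \<in> {0..len G e}"
    show "((\<lambda>x. walk_sign p e * H (pos e x)) has_real_derivative h (pos e x)) (at x within {0..len G e})"
      using DERIV_cmult[OF pull_derivative[OF H e x], of "walk_sign p e"]
      by (simp add: walk_sign_square flip: mult.assoc)
  qed (use h len_pos pull_continuous in \<open>auto simp: less_imp_le\<close>)
  also have "\<dots> = H L - H 0"
    using walk_telescope[OF circuit trail, of "\<lambda>_. 1" H "len G" 0]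
    by (simp add: covers walk_length_circuit right_diff_distrib)
  also have "\<dots> = (LBINT x:{0..L}. h x)"
    using L_pos by (intro LBINT_FTC[symmetric] H h) auto
  finally show ?thesis .
qed

lemma pull_inner:
  assumes "continuous_on {0..L} (f 0)" "continuous_on {0..L} (g 0)"
  shows "L2_inner G (\<lambda>e x. f 0 (pos e x)) (\<lambda>e x. g 0 (pos e x)) = L2_inner C f g"
  unfolding L2_inner_loop_graph L2_inner_def[of G]
  using assms by (intro pull_integral continuous_intros)

text \<open>The inclusion of form domains in weak form. Continuity of \<open>f\<close> at the
  vertices makes it a continuous function along the circuit, with zero end values by the Dirichlet
  condition at \<open>d\<close>, hence a valid test function for the loop. The sign makes the second
  factor the derivative of the pulled-back \<open>g\<close>.\<close>

lemma green_identity_pull: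
  assumes f: "eigenpair f f' m" and g: "loop.eigenpair g g' m'"
  shows "L2_inner G f' (\<lambda>e x. walk_sign p e * g' 0 (pos e x)) = m' * L2_inner G f (\<lambda>e x. g 0 (pos e x))"
proof -
  obtain val where val: "\<And>e. e \<in> edges G \<Longrightarrow> f e 0 = val (tail (skel G) e) \<and> f e (len G e) = val (head (skel G) e)"
      "\<And>v. v \<in> dirichlet G \<Longrightarrow> val v = 0"
    using f unfolding eigenpair_def vertex_conditions_def by blast
  have g': "(g' 0 has_real_derivative - (m' * g 0 y)) (at y within {0..L})" if "y \<in> {0..L}" for y
    using loop.eigenpairD(2)[OF g, of 0 y] that by simp
  have cg: "continuous_on {0..L} (g 0)" using loop.eigenpairD(3)[OF g, of 0] by simp
  have "L2_inner G f' (\<lambda>e x. walk_sign p e * g' 0 (pos e x))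
      = (\<Sum>e\<in>edges G. f e (len G e) * (walk_sign p e * g' 0 (pos e (len G e))) - f e 0 * (walk_sign p e * g' 0 (pos e 0))
      - (LBINT x:{0..len G e}. f e x * - (m' * g 0 (pos e x))))"
    unfolding L2_inner_def graph_integral_def
  proof (rule sum.cong[OF refl])
    fix e assume e: "e \<in> edges G"
    have "((\<lambda>x. walk_sign p e * g' 0 (pos e x)) has_real_derivative - (m' * g 0 (pos e x))) (at x within {0..len G e})"
      if "x \<in> {0..len G e}" for x
      using DERIV_cmult[OF pull_derivative[OF g' e that], of "walk_sign p e"]
      by (simp add: walk_sign_square flip: mult.assoc)
    then show "(LBINT x:{0..len G e}. f' e x * (walk_sign p e * g' 0 (pos e x)))
        = f e (len G e) * (walk_sign p e * g' 0 (pos e (len G e))) - f e 0 * (walk_sign p e * g' 0 (pos e 0))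
        - (LBINT x:{0..len G e}. f e x * - (m' * g 0 (pos e x)))"
      using len_pos[OF e]
      by (intro integration_by_parts_Icc eigenpairD[OF f e] continuous_intros pull_continuous[OF cg e]) auto
  qed
  also have "\<dots> = (\<Sum>e\<in>edges G. walk_sign p e *
        (val (head (skel G) e) * g' 0 (pos e (len G e)) - val (tail (skel G) e) * g' 0 (pos e 0)))
      + (\<Sum>e\<in>edges G. m' * (LBINT x:{0..len G e}. f e x * g 0 (pos e x)))"
    unfolding sum.distrib[symmetric]
  proof (intro sum.cong refl)
    fix e assume e: "e \<in> edges G"
    have "(\<lambda>x. f e x * - (m' * g 0 (pos e x))) = (\<lambda>x. - m' * (f e x * g 0 (pos e x)))" by auto
    then have "(LBINT x:{0..len G e}. f e x * - (m' * g 0 (pos e x))) = - m' * (LBINT x:{0..len G e}. f e x * g 0 (pos e x))"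
      by (simp only: set_integral_mult_right)
    then show "f e (len G e) * (walk_sign p e * g' 0 (pos e (len G e))) - f e 0 * (walk_sign p e * g' 0 (pos e 0))
        - (LBINT x:{0..len G e}. f e x * - (m' * g 0 (pos e x)))
        = walk_sign p e * (val (head (skel G) e) * g' 0 (pos e (len G e)) - val (tail (skel G) e) * g' 0 (pos e 0))
          + m' * (LBINT x:{0..len G e}. f e x * g 0 (pos e x))"
      using val(1)[OF e] by (simp add: algebra_simps)
  qed
  also have "\<dots> = m' * L2_inner G f (\<lambda>e x. g 0 (pos e x))"
    using telescope[of val "g' 0"] val(2)[OF dirichlet]
    by (simp add: L2_inner_def graph_integral_def sum_distrib_left)
  finally show ?thesis .
qed

text \<open>Both sides are compared through 2<f,1> - |f'|^2 - s|f|^2 at one function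
  \<open>f\<close>: the left side is its exact value, and the right side bounds it by completing the
  square in each mode of the loop.\<close>

lemma resolvent_sum_le:
  assumes G: "eigenbasis G lam \<phi>" and C: "eigenbasis C \<mu> \<psi>" and s: "0 < s"
  shows "summable (\<lambda>m. (L2_inner C (\<lambda>e x. 1) (\<psi> m))\<^sup>2 / (\<mu> m + s)) \<and>
    (\<Sum>n<N. (L2_inner G (\<lambda>e x. 1) (\<phi> n))\<^sup>2 / (lam n + s))
      \<le> (\<Sum>m. (L2_inner C (\<lambda>e x. 1) (\<psi> m))\<^sup>2 / (\<mu> m + s))"
proof -
  define a where "a n = L2_inner G (\<lambda>e x. 1) (\<phi> n)" for n
  define b where "b m = L2_inner C (\<lambda>e x. 1) (\<psi> m)" for m
  have lam: "0 < lam n" and \<mu>: "0 < \<mu> n" for n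
    by (rule eigenbasis_pos[OF G], rule eigenbasis_pos[OF C])
  have ob: "orthonormal_basis G \<phi>" "orthonormal_basis C \<psi>" using G C by (auto simp: eigenbasis_def)
  then have on\<phi>: "\<And>n. \<phi> n \<in> L2 G" "\<And>m n. L2_inner G (\<phi> m) (\<phi> n) = (if m = n then 1 else 0)"
    and on\<psi>: "\<And>m n. L2_inner C (\<psi> m) (\<psi> n) = (if m = n then 1 else 0)"
    by (auto simp: orthonormal_basis_def)
  have "\<exists>f'. eigenpair (\<phi> n) f' (lam n)" for n
    using G by (intro eigenpair_exists) (simp add: eigenbasis_def)
  then obtain \<phi>' where \<phi>': "\<And>n. eigenpair (\<phi> n) (\<phi>' n) (lam n)" by metis
  have "\<exists>f'. loop.eigenpair (\<psi> m) f' (\<mu> m)" for m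
    using C by (intro loop.eigenpair_exists) (simp add: eigenbasis_def)
  then obtain \<psi>' where \<psi>': "\<And>m. loop.eigenpair (\<psi> m) (\<psi>' m) (\<mu> m)" by metis
  have c\<psi>: "continuous_on {0..L} (\<psi> m 0)" "continuous_on {0..L} (\<psi>' m 0)" for m
    using loop.eigenpairD(3,4)[OF \<psi>', of 0 m] by auto
  have \<phi>'L2: "\<phi>' n \<in> L2 G" for n
    by (intro L2_continuous eigenpairD(4)[OF \<phi>'])
  have \<phi>'o: "L2_inner G (\<phi>' m) (\<phi>' n) = (if m = n then lam m else 0)" for m n
    using green_identity[OF \<phi>' \<phi>', of m n] on\<phi>(2) by simp

  define P where "P = (\<lambda>m e x. \<psi> m 0 (pos e x))"
  define P' where "P' = (\<lambda>m e x. walk_sign p e * \<psi>' m 0 (pos e x))"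
  have PL2: "P m \<in> L2 G" for m
    unfolding P_def by (intro L2_continuous pull_continuous c\<psi>)
  have P'L2: "P' m \<in> L2 G" for m
    unfolding P'_def by (intro L2_continuous continuous_intros pull_continuous c\<psi>)
  have Po: "L2_inner G (P m) (P n) = (if m = n then 1 else 0)" for m n
    unfolding P_def pull_inner[of "\<psi> m" "\<psi> n", OF c\<psi>(1) c\<psi>(1)] on\<psi> ..
  have P'o: "L2_inner G (P' m) (P' n) = (if m = n then \<mu> m else 0)" for m n
  proof -
    have "P' m e x * P' n e x = \<psi>' m 0 (pos e x) * \<psi>' n 0 (pos e x)" for e x
      using walk_sign_square[of p e] by (simp add: P'_def mult_ac)
    then have "L2_inner G (P' m) (P' n) = L2_inner G (\<lambda>e x. \<psi>' m 0 (pos e x)) (\<lambda>e x. \<psi>' n 0 (pos e x))"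
      by (simp add: L2_inner_def)
    also have "\<dots> = L2_inner C (\<psi>' m) (\<psi>' n)" by (intro pull_inner c\<psi>)
    also have "\<dots> = \<mu> n * (if m = n then 1 else 0)"
      using loop.green_identity[OF \<psi>' \<psi>', of m n] on\<psi> by simp
    finally show ?thesis by simp
  qed

  \<comment> \<open>These coefficients maximise the functional on the span of the first
    \<open>N\<close> eigenfunctions; \<open>value_f\<close> computes the maximum.\<close>
  define c where "c n = a n / (lam n + s)" for n
  define f where "f = (\<lambda>e x. \<Sum>n<N. c n * \<phi> n e x)"
  define f' where "f' = (\<lambda>e x. \<Sum>n<N. c n * \<phi>' n e x)"
  have fL2: "f \<in> L2 G" unfolding f_def by (intro L2_sum L2_scale on\<phi>)
  have f'L2: "f' \<in> L2 G" unfolding f'_def by (intro L2_sum L2_scale \<phi>'L2)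
  define \<delta> where "\<delta> m = L2_inner G f (P m)" for m
  have f'P': "L2_inner G f' (P' m) = \<mu> m * \<delta> m" for m
  proof -
    have "L2_inner G f' (P' m) = (\<Sum>n<N. c n * L2_inner G (\<phi>' n) (P' m))"
      unfolding f'_def by (subst L2_inner_sum_left) (auto intro: L2_scale \<phi>'L2 P'L2 simp: L2_inner_scale_left)
    also have "\<dots> = (\<Sum>n<N. c n * (\<mu> m * L2_inner G (\<phi> n) (P m)))"
      unfolding P'_def P_def green_identity_pull[OF \<phi>' \<psi>'] ..
    also have "\<dots> = \<mu> m * \<delta> m"
      unfolding \<delta>_def f_def
      by (subst L2_inner_sum_left)
        (auto intro: L2_scale on\<phi> PL2 simp: L2_inner_scale_left sum_distrib_left mult.left_commute)
    finally show ?thesis .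
  qed
  \<comment> \<open>Bessel goes the right way here: mass and energy enter the functional with a
    minus sign, so replacing them by partial sums can only increase it.\<close>
  have energy: "(\<Sum>m<M. \<mu> m * (\<delta> m)\<^sup>2) \<le> L2_inner G f' f'" for M
    by (rule bessel_inequality[OF f'L2 P'L2]) (auto simp: P'o f'P')
  have mass: "(\<Sum>m<M. (\<delta> m)\<^sup>2) \<le> L2_inner G f f" for M
    using bessel_inequality[OF fL2, where M = M and p = P and \<mu> = "\<lambda>_. 1" and d = \<delta>] Po PL2
    by (simp add: \<delta>_def)
  have f1: "L2_inner G f (\<lambda>e x. 1) = (\<Sum>n<N. c n * a n)"
    unfolding f_def a_def
    by (subst L2_inner_sum_left)
      (auto intro: L2_scale on\<phi> L2_const simp: L2_inner_scale_left L2_inner_commute[of "\<lambda>e x. 1"])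
  have ff: "L2_inner G f f = (\<Sum>n<N. (c n)\<^sup>2)"
    unfolding f_def using L2_inner_orthogonal_sum[of N \<phi> "\<lambda>_. 1" c] on\<phi> by simp
  have f'f': "L2_inner G f' f' = (\<Sum>n<N. lam n * (c n)\<^sup>2)"
    unfolding f'_def using L2_inner_orthogonal_sum[of N \<phi>' lam c] \<phi>'L2 \<phi>'o by simp
  have value_f: "2 * L2_inner G f (\<lambda>e x. 1) - L2_inner G f' f' - s * L2_inner G f f
      = (\<Sum>n<N. (a n)\<^sup>2 / (lam n + s))"
    unfolding f1 ff f'f' sum_distrib_left sum_subtractf[symmetric]
  proof (intro sum.cong refl)
    fix n
    have "lam n + s \<noteq> 0" using lam[of n] s by linarith
    then have a: "a n = c n * (lam n + s)" by (simp add: c_def)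
    show "2 * (c n * a n) - lam n * (c n)\<^sup>2 - s * (c n)\<^sup>2 = (a n)\<^sup>2 / (lam n + s)"
      using \<open>lam n + s \<noteq> 0\<close> unfolding a by (simp add: power2_eq_square) (simp add: algebra_simps)
  qed

  have "L2_sums C (\<lambda>m e x. b m * \<psi> m e x) (\<lambda>e x. 1)"
    using ob(2) loop.L2_const[of 1] unfolding orthonormal_basis_def b_def by blast
  \<comment> \<open>The constant 1 pulls back to itself, so its expansion in the loop basis becomes
    one in the functions \<open>P m\<close> on \<open>G\<close>.\<close>
  moreover have "L2_inner C (\<lambda>e x. 1 - (\<Sum>m<M. b m * \<psi> m e x)) (\<lambda>e x. 1 - (\<Sum>m<M. b m * \<psi> m e x))
      = L2_inner G (\<lambda>e x. 1 - (\<Sum>m<M. b m * P m e x)) (\<lambda>e x. 1 - (\<Sum>m<M. b m * P m e x))" for M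
    unfolding P_def by (rule pull_inner[symmetric]) (intro continuous_intros c\<psi>)+
  ultimately have "L2_sums G (\<lambda>m e x. b m * P m e x) (\<lambda>e x. 1)"
    by (simp add: L2_sums_def L2_norm_def)
  then have "(\<lambda>m. L2_inner G (\<lambda>e x. b m * P m e x) f) sums L2_inner G (\<lambda>e x. 1) f"
    by (rule L2_sums_inner) (intro L2_scale PL2 L2_const fL2)+
  then have b\<delta>: "(\<lambda>m. b m * \<delta> m) sums L2_inner G f (\<lambda>e x. 1)"
    by (simp add: L2_inner_scale_left \<delta>_def L2_inner_commute[of f])

  have "summable (\<lambda>m. b m * b m)"
    using loop.orthonormal_basis_parseval[OF ob(2) loop.L2_const loop.L2_const, of 1 1] sums_summable
    unfolding b_def by blast
  then have "summable (\<lambda>m. (b m)\<^sup>2 / s)" by (intro summable_divide) (simp add: power2_eq_square)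
  then have sum_b: "summable (\<lambda>m. (b m)\<^sup>2 / (\<mu> m + s))"
  proof (rule summable_comparison_test')
    fix m :: nat
    have "0 \<le> (b m)\<^sup>2 / (\<mu> m + s)" "(b m)\<^sup>2 / (\<mu> m + s) \<le> (b m)\<^sup>2 / s"
      using \<mu>[of m] s by (auto intro: divide_left_mono)
    then show "norm ((b m)\<^sup>2 / (\<mu> m + s)) \<le> (b m)\<^sup>2 / s"
      unfolding real_norm_def by linarith
  qed
  let ?B = "\<Sum>m. (b m)\<^sup>2 / (\<mu> m + s)"
  have le: "2 * (\<Sum>m<M. b m * \<delta> m) \<le> ?B + L2_inner G f' f' + s * L2_inner G f f" for M
  proof -
    \<comment> \<open>With t = \<mu> m + s this is 2 b \<delta> - t \<delta>^2 <= b^2 / t, a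
      completed square.\<close>
    have "2 * (b m * \<delta> m) - \<mu> m * (\<delta> m)\<^sup>2 - s * (\<delta> m)\<^sup>2 \<le> (b m)\<^sup>2 / (\<mu> m + s)" for m
    proof -
      define t where "t = \<mu> m + s"
      have t: "0 < t" using \<mu>[of m] s by (simp add: t_def)
      have "0 \<le> (b m - t * \<delta> m)\<^sup>2 / t" using t by simp
      also have "\<dots> = (b m)\<^sup>2 / t - 2 * (b m * \<delta> m) + t * (\<delta> m)\<^sup>2"
        using t by (simp add: power2_eq_square field_simps)
      finally show ?thesis by (simp add: t_def algebra_simps)
    qed
    then have "(\<Sum>m<M. 2 * (b m * \<delta> m) - \<mu> m * (\<delta> m)\<^sup>2 - s * (\<delta> m)\<^sup>2) \<le> (\<Sum>m<M. (b m)\<^sup>2 / (\<mu> m + s))"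
      by (intro sum_mono)
    also have "\<dots> \<le> ?B"
      using less_imp_le[OF add_pos_pos[OF \<mu> s]] by (intro sum_le_suminf sum_b) auto
    finally have "2 * (\<Sum>m<M. b m * \<delta> m) - (\<Sum>m<M. \<mu> m * (\<delta> m)\<^sup>2) - s * (\<Sum>m<M. (\<delta> m)\<^sup>2) \<le> ?B"
      by (simp add: sum_subtractf sum_distrib_left)
    moreover have "s * (\<Sum>m<M. (\<delta> m)\<^sup>2) \<le> s * L2_inner G f f" using mass s by (intro mult_left_mono) auto
    ultimately show ?thesis using energy[of M] by linarith
  qed
  \<comment> \<open>The bound \<open>le\<close> is uniform in \<open>M\<close>, so the limit can be
    taken on its left side alone.\<close>
  have "(\<lambda>M. 2 * (\<Sum>m<M. b m * \<delta> m)) \<longlonglongrightarrow> 2 * L2_inner G f (\<lambda>e x. 1)"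
    using b\<delta> unfolding sums_def by (intro tendsto_mult_left)
  then have "2 * L2_inner G f (\<lambda>e x. 1) \<le> ?B + L2_inner G f' f' + s * L2_inner G f f"
    by (rule LIMSEQ_le_const2) (use le in blast)
  then have "(\<Sum>n<N. (a n)\<^sup>2 / (lam n + s)) \<le> ?B" using value_f by linarith
  then show ?thesis using sum_b unfolding a_def b_def by blast
qed

lemma torsional_rigidity_le_loop:
  assumes \<alpha>: "0 < \<alpha>" "\<alpha> < 1"
  shows "torsional_rigidity \<alpha> G \<le> torsional_rigidity \<alpha> C"
proof -
  have "frac_laplacian \<alpha> C (torsion_function \<alpha> C) (\<lambda>e x. 1)"
    by (rule torsion_function_solves[OF frac_laplacian_loop_graph_exists[OF L_pos \<alpha>(1)]])
  then obtain \<mu> \<psi> where C: "eigenbasis C \<mu> \<psi>"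
    and sC: "(\<lambda>m. (L2_inner C (\<lambda>e x. 1) (\<psi> m))\<^sup>2 * \<mu> m powr - \<alpha>) sums torsional_rigidity \<alpha> C"
    unfolding torsional_rigidity_def by (rule loop.frac_laplacian_one_sums)
  show ?thesis
  proof (cases "\<exists>u. frac_laplacian \<alpha> G u (\<lambda>e x. 1)")
    case True
    then have "frac_laplacian \<alpha> G (torsion_function \<alpha> G) (\<lambda>e x. 1)"
      by (rule torsion_function_solves)
    then obtain lam \<phi> where G: "eigenbasis G lam \<phi>"
      and sG: "(\<lambda>n. (L2_inner G (\<lambda>e x. 1) (\<phi> n))\<^sup>2 * lam n powr - \<alpha>) sums torsional_rigidity \<alpha> G"
      unfolding torsional_rigidity_def by (rule frac_laplacian_one_sums)
    have le: "(\<Sum>n<N. (L2_inner G (\<lambda>e x. 1) (\<phi> n))\<^sup>2 * lam n powr - \<alpha>) \<le> torsional_rigidity \<alpha> C" for N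
      using sum_powr_le_of_sum_resolvent_le[OF \<alpha> _ _ eigenbasis_pos[OF G] eigenbasis_pos[OF C] resolvent_sum_le[OF G C] sums_summable[OF sC], of N]
        sums_unique[OF sC] by simp
    from sG[unfolded sums_def] show ?thesis
      by (rule LIMSEQ_le_const2) (use le in blast)
  next
    case False
    have "0 \<le> torsional_rigidity \<alpha> C" using sums_le[OF _ sums_zero sC] by simp
    moreover have "torsional_rigidity \<alpha> G = 0"
      using False by (simp add: torsional_rigidity_def torsion_function_def graph_integral_def)
    ultimately show ?thesis by simp
  qed
qed

end

theorem theorem6p2:
  fixes \<alpha> :: real and G :: "('v, 'e) metric_graph"
  assumes "0 < \<alpha>" and "\<alpha> < 1"
    and "metric_graph G"
    and "connected_space (graph_space G)"
    and "dirichlet G \<noteq> {}"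
    and "\<forall>v\<in>vertices G. even (vertex_degree G v)"
  shows "\<exists>C :: (nat, nat) metric_graph.
           cycle_graph C \<and> dirichlet C \<noteq> {} \<and>
           total_length C = total_length G \<and>
           torsional_rigidity \<alpha> G \<le> torsional_rigidity \<alpha> C"
proof -
  interpret metric_graph G by fact
  obtain d where d: "d \<in> dirichlet G" using assms(5) by blast
  then have "d \<in> vertices G" using dirichlet_subset by blast
  have even: "even (in_degree (skel G) v + out_degree (skel G) v)" if "v \<in> vertices G" for v
    using assms(6) that unfolding vertex_degree_def by blast
  obtain p where p: "walk (skel G) d p d" "distinct (map fst p)" "fst ` set p = edges G"
    by (rule euler_circuit[OF fin_digraph_skel even connected_space_imp_connected[OF assms(4)]
          \<open>d \<in> vertices G\<close>])
  interpret euler_graph G p d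
    by unfold_locales (use p d in auto)
  show ?thesis
    using cycle_graph_loop_graph[OF L_pos] total_length_loop_graph[of L]
      torsional_rigidity_le_loop[OF assms(1,2)]
    by (intro exI[of _ C]) auto
qed

end
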